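(* Let $G$ be a finite abelian group. GCLF problems with group $G$ can be solved in strongly polynomial time.
   Context: A lattice $\mathcal{L}\subseteq 2^N$ on a finite set $N$ is a set family closed under union and intersection; it is given by an acyclic digraph $D$ on vertex set $N$ such that $X\subseteq N$ belongs to $\mathcal{L}$ iff no arc of $D$ enters $X$. A GCLF (group-constrained lattice feasibility) problem is given by a finite set $N$, such a lattice $\mathcal{L}\subseteq 2^N$, a finite abelian group $G$, a map $\gamma\colon N\to G$ and $r\in G$; the task is to find $X\in\mathcal{L}$ with $\gamma(X):=\sum_{v\in X}\gamma(v)=r$, or decide that none exists. *)

theory Defs
  imports
    "HOL-Algebra.FiniteProduct"
    "HOL-Library.Log_Nat"
    "HOL-Computational_Algebra.Polynomial"
begin

section \<open>Group-constrained lattice feasibility\<close>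

text \<open>The lattice given by a digraph with arc set \<open>D\<close> on \<open>N\<close>: the sets that no arc enters. An arc
  \<open>(u, v)\<close> goes from \<open>u\<close> to \<open>v\<close>, and it enters \<open>X\<close> if \<open>u \<notin> X\<close> and \<open>v \<in> X\<close>.\<close>

definition enters :: "'v \<times> 'v \<Rightarrow> 'v set \<Rightarrow> bool" where
  "enters a X \<longleftrightarrow> fst a \<notin> X \<and> snd a \<in> X"

definition lattice_of :: "'v set \<Rightarrow> ('v \<times> 'v) set \<Rightarrow> 'v set set" where
  "lattice_of N D = {X. X \<subseteq> N \<and> \<not> (\<exists>a\<in>D. enters a X)}"

lemma lattice_of_Un: "X \<in> lattice_of N D \<Longrightarrow> Y \<in> lattice_of N D \<Longrightarrow> X \<union> Y \<in> lattice_of N D"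
  by (auto simp: lattice_of_def enters_def)

lemma lattice_of_Int: "X \<in> lattice_of N D \<Longrightarrow> Y \<in> lattice_of N D \<Longrightarrow> X \<inter> Y \<in> lattice_of N D"
  by (auto simp: lattice_of_def enters_def)

record ('v, 'g) gclf =
  ground :: "'v set"
  arcs :: "('v \<times> 'v) set"
  label :: "'v \<Rightarrow> 'g"
  target :: 'g

definition gclf_problem :: "('g, 'm) monoid_scheme \<Rightarrow> ('v, 'g) gclf \<Rightarrow> bool" where
  "gclf_problem G P \<longleftrightarrow>
     finite (ground P) \<and> arcs P \<subseteq> ground P \<times> ground P \<and> acyclic (arcs P) \<and>
     label P \<in> ground P \<rightarrow> carrier G \<and> target P \<in> carrier G"

text \<open>Groups of the library are written multiplicatively, so the group sum of the labels of \<open>X\<close>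
  appears as \<^const>\<open>finprod\<close>.\<close>

definition gclf_solution :: "('g, 'm) monoid_scheme \<Rightarrow> ('v, 'g) gclf \<Rightarrow> 'v set \<Rightarrow> bool" where
  "gclf_solution G P X \<longleftrightarrow>
     X \<in> lattice_of (ground P) (arcs P) \<and> finprod G (label P) X = target P"


section \<open>Strongly polynomial time\<close>

text \<open>A random access machine on rational numbers, programmed by structured programs. A state
  consists of registers and an indirectly addressed memory. Every instruction performs one
  elementary operation (arithmetic operation, comparison, or move of one number).\<close>

datatype arith = Add | Subtract | Multiply | Divide

fun arith_op :: "arith \<Rightarrow> rat \<Rightarrow> rat \<Rightarrow> rat" where
  "arith_op Add x y = x + y"
| "arith_op Subtract x y = x - y"
| "arith_op Multiply x y = x * y"
| "arith_op Divide x y = x / y"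

datatype prog =
    LoadConst nat rat               (* R i := c *)
  | Arith arith nat nat nat         (* R i := R j op R k *)
  | Load nat nat                    (* R i := M (R j) *)
  | Store nat nat                   (* M (R i) := R j *)
  | Seq prog prog
  | IfLe nat nat prog prog          (* if R i <= R j then ... else ... *)
  | WhileLe nat nat prog            (* while R i <= R j do ... *)

type_synonym state = "(nat \<Rightarrow> rat) \<times> (nat \<Rightarrow> rat)"

text \<open>Encoding length of a rational number in lowest terms: a sign bit plus the numbers of binary
  digits of numerator and denominator.\<close>

definition rat_bits :: "rat \<Rightarrow> nat" where
  "rat_bits x = (case quotient_of x of (p, q) \<Rightarrow> 1 + floorlog 2 (nat \<bar>p\<bar>) + floorlog 2 (nat q))"

text \<open>\<open>exec c s t b s'\<close>: started in state \<open>s\<close>, the program \<open>c\<close> terminates in state \<open>s'\<close> after \<open>t\<close>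
  elementary operations, and \<open>b\<close> is the largest encoding length of a number written during the
  run. Since at most \<open>t\<close> numbers are written, bounds on \<open>t\<close> and \<open>b\<close> also bound the space. A
  run that never ends, or that uses an address that is not a natural number or divides by zero,
  has no derivation.\<close>

inductive exec :: "prog \<Rightarrow> state \<Rightarrow> nat \<Rightarrow> nat \<Rightarrow> state \<Rightarrow> bool" where
  LoadConst: "exec (LoadConst i c) (R, M) 1 (rat_bits c) (R(i := c), M)"
| Arith: "x = arith_op f (R j) (R k) \<Longrightarrow> \<not> (f = Divide \<and> R k = 0) \<Longrightarrow>
    exec (Arith f i j k) (R, M) 1 (rat_bits x) (R(i := x), M)"
| Load: "R j = of_nat a \<Longrightarrow> exec (Load i j) (R, M) 1 (rat_bits (M a)) (R(i := M a), M)"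
| Store: "R i = of_nat a \<Longrightarrow> exec (Store i j) (R, M) 1 (rat_bits (R j)) (R, M(a := R j))"
| Seq: "exec c1 s t1 b1 s1 \<Longrightarrow> exec c2 s1 t2 b2 s2 \<Longrightarrow>
    exec (Seq c1 c2) s (t1 + t2) (max b1 b2) s2"
| IfTrue: "fst s i \<le> fst s j \<Longrightarrow> exec c1 s t b s' \<Longrightarrow> exec (IfLe i j c1 c2) s (t + 1) b s'"
| IfFalse: "\<not> fst s i \<le> fst s j \<Longrightarrow> exec c2 s t b s' \<Longrightarrow> exec (IfLe i j c1 c2) s (t + 1) b s'"
| WhileFalse: "\<not> fst s i \<le> fst s j \<Longrightarrow> exec (WhileLe i j c) s 1 0 s"
| WhileTrue: "fst s i \<le> fst s j \<Longrightarrow> exec c s t1 b1 s1 \<Longrightarrow> exec (WhileLe i j c) s1 t2 b2 s2 \<Longrightarrow>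
    exec (WhileLe i j c) s (t1 + t2 + 1) (max b1 b2) s2"


lemma exec_deterministic:
  "exec c s t b s' \<Longrightarrow> exec c s u d s'' \<Longrightarrow> t = u \<and> b = d \<and> s' = s''"
proof (induction arbitrary: u d s'' rule: exec.induct)
  case (LoadConst i c R M)
  show ?case using LoadConst.prems by cases simp
next
  case (Arith x f R j k i M)
  show ?case using Arith.prems by cases (simp add: Arith.hyps)
next
  case (Load R j a i M)
  show ?case using Load.prems by cases (simp add: Load.hyps)
next
  case (Store R i a j M)
  show ?case using Store.prems by cases (simp add: Store.hyps)
next
  case (Seq c1 s t1 b1 s1 c2 t2 b2 s2)
  from Seq.prems show ?case
  proof cases
    case (Seq t1' b1' s1' t2' b2')
    with Seq.IH show ?thesis by blast
  qed
next
  case (IfTrue s i j c1 t b s' c2)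
  show ?case using IfTrue.prems by cases (use IfTrue.hyps IfTrue.IH in blast)+
next
  case (IfFalse s i j c2 t b s' c1)
  show ?case using IfFalse.prems by cases (use IfFalse.hyps IfFalse.IH in blast)+
next
  case (WhileFalse s i j c)
  show ?case using WhileFalse.prems by cases (simp_all add: WhileFalse.hyps)
next
  case (WhileTrue s i j c t1 b1 s1 t2 b2 s2)
  show ?case using WhileTrue.prems by cases (use WhileTrue.hyps WhileTrue.IH in blast)+
qed

text \<open>Input and output are lists of numbers, kept in the first memory cells, with the length of the
  list in register 0. All other registers and cells are initially 0.\<close>

definition init_state :: "rat list \<Rightarrow> state" where
  "init_state xs =
     ((\<lambda>i. if i = 0 then of_nat (length xs) else 0), (\<lambda>a. if a < length xs then xs ! a else 0))"

definition holds_output :: "state \<Rightarrow> rat list \<Rightarrow> bool" where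
  "holds_output s ys \<longleftrightarrow>
     fst s 0 = of_nat (length ys) \<and> (\<forall>a < length ys. snd s a = ys ! a)"

text \<open>The problem consists of the instances \<open>I\<close>, their encoding \<open>enc\<close> as lists of numbers, and the
  relation \<open>ok\<close> between instances and correct outputs. Strongly polynomial: the number of
  elementary operations is bounded by a polynomial in the number of input numbers, and the encoding
  lengths of all numbers that occur are bounded by a polynomial in the total encoding length of the
  input.\<close>

definition solvable_in_strongly_polynomial_time ::
    "'i set \<Rightarrow> ('i \<Rightarrow> rat list) \<Rightarrow> ('i \<Rightarrow> rat list \<Rightarrow> bool) \<Rightarrow> bool" where
  "solvable_in_strongly_polynomial_time I enc ok \<longleftrightarrow>
     (\<exists>(c :: prog) (p :: nat poly) (q :: nat poly). \<forall>x\<in>I. \<exists>t b s ys.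
        exec c (init_state (enc x)) t b s \<and>
        t \<le> poly p (length (enc x)) \<and>
        b \<le> poly q (\<Sum>z\<leftarrow>enc x. rat_bits z) \<and>
        holds_output s ys \<and> ok x ys)"


section \<open>GCLF as a computational problem\<close>

text \<open>An instance is presented with a listing \<open>vs\<close> of its ground set: the number of elements, the
  adjacency matrix of the digraph (row by row), the labels, and the target. The map \<open>e\<close> numbers
  the elements of the group.\<close>

definition gclf_instances ::
    "('g, 'm) monoid_scheme \<Rightarrow> ('v list \<times> ('v, 'g) gclf) set" where
  "gclf_instances G = {(vs, P). gclf_problem G P \<and> distinct vs \<and> set vs = ground P}"

definition gclf_encoding :: "('g \<Rightarrow> nat) \<Rightarrow> 'v list \<times> ('v, 'g) gclf \<Rightarrow> rat list" where
  "gclf_encoding e = (\<lambda>(vs, P).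
     [of_nat (length vs)] @
     concat (map (\<lambda>u. map (\<lambda>v. if (u, v) \<in> arcs P then 1 else 0) vs) vs) @
     map (\<lambda>v. of_nat (e (label P v))) vs @
     [of_nat (e (target P))])"

text \<open>A correct output is 1 followed by the characteristic vector of a solution, or the single
  number 0 if there is no solution.\<close>

definition gclf_correct_output ::
    "('g, 'm) monoid_scheme \<Rightarrow> 'v list \<times> ('v, 'g) gclf \<Rightarrow> rat list \<Rightarrow> bool" where
  "gclf_correct_output G = (\<lambda>(vs, P) ys.
     (\<exists>X. gclf_solution G P X \<and> ys = 1 # map (\<lambda>v. if v \<in> X then 1 else 0) vs) \<or>
     ((\<nexists>X. gclf_solution G P X) \<and> ys = [0]))"

end

theory Submission
  imports Defs
begin

text \<open>Let \<open>X\<close> be a solution of least size. A set of maximal elements of \<open>X\<close> with zero sum can be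
  removed from \<open>X\<close>, and among \<open>card G\<close> elements there is a nonempty set with zero sum because two of
  the partial sums coincide. So \<open>X\<close> has fewer than \<open>card G\<close> maximal elements, and it consists of the
  elements from which they can be reached. As \<open>G\<close> is fixed, only polynomially many sets, generated
  by at most \<open>card G\<close> elements each, have to be tested. The machine computes reachability by
  Warshall's algorithm and then lists the generated sets in the order of an \<open>n\<close>-ary tree, the
  children of a set being its unions with the sets generated by single elements.\<close>

section \<open>Structured programs with bounded values\<close>

text \<open>The machine counts every operation and measures every number written, so cost must be
  bounded along with correctness. A single number \<open>X\<close>, polynomial in the number
  \<open>n\<close> of elements, does this: it bounds all variables and all memory cells throughout
  the run. Every loop runs up to the value of a variable, so \<open>X\<close> also bounds the
  iterations; and since the values themselves are polynomial in \<open>n\<close>, a value can serve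
  as a bound on its own encoding length. Time and size bounds are then read off the program text,
  and the Hoare rules ask only for functional correctness and for stored values of at most
  \<open>X\<close>.

  The program must not depend on the instance, but it may depend on the group: its order, unit and
  multiplication table are constants in the program text.

  Numbering the generated sets as tree nodes spares integer division, as the index of a child is
  computed from its parent by multiplication and addition. Each generator multiplies the bound on
  the index by \<open>n + 1\<close>, which gives \<open>(n + 1) ^ card (carrier G)\<close>
  nodes.\<close>

datatype exp = Const nat | Var nat | Plus exp exp | Times exp exp | Mem exp

primrec eval :: "(nat \<Rightarrow> nat) \<Rightarrow> (nat \<Rightarrow> nat) \<Rightarrow> exp \<Rightarrow> nat" where
  "eval v m (Const c) = c"
| "eval v m (Var x) = v x"
| "eval v m (Plus a b) = eval v m a + eval v m b"
| "eval v m (Times a b) = eval v m a * eval v m b"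
| "eval v m (Mem a) = m (eval v m a)"

primrec vars :: "exp \<Rightarrow> nat set" where
  "vars (Const c) = {}"
| "vars (Var x) = {x}"
| "vars (Plus a b) = vars a \<union> vars b"
| "vars (Times a b) = vars a \<union> vars b"
| "vars (Mem a) = vars a"

text \<open>The exponent of a power of \<open>X\<close> that bounds the expression and all its
  subexpressions, since intermediate values are written too. A constant gets itself as degree
  because \<open>c \<le> 2 ^ c\<close>. The extra 1 of a sum pays for the factor 2 in
  \<open>a + b \<le> 2 * (a * b)\<close> for positive bounds; the extra 1 of a memory access covers
  a cell content of up to \<open>X\<close> at an address of degree 0.\<close>

primrec edeg :: "exp \<Rightarrow> nat" where
  "edeg (Const c) = c"
| "edeg (Var x) = 1"
| "edeg (Plus a b) = edeg a + edeg b + 1"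
| "edeg (Times a b) = edeg a + edeg b"
| "edeg (Mem a) = edeg a + 1"

primrec etime :: "exp \<Rightarrow> nat" where
  "etime (Const c) = 1"
| "etime (Var x) = 2"
| "etime (Plus a b) = etime a + etime b + 1"
| "etime (Times a b) = etime a + etime b + 1"
| "etime (Mem a) = etime a + 1"

text \<open>There is no move instruction, so a register is copied by adding it to 0.\<close>

primrec ecomp :: "nat \<Rightarrow> exp \<Rightarrow> prog" where
  "ecomp d (Const c) = LoadConst d (of_nat c)"
| "ecomp d (Var x) = Seq (LoadConst d 0) (Arith Add d d x)"
| "ecomp d (Plus a b) = Seq (Seq (ecomp d a) (ecomp (Suc d) b)) (Arith Add d d (Suc d))"
| "ecomp d (Times a b) = Seq (Seq (ecomp d a) (ecomp (Suc d) b)) (Arith Multiply d d (Suc d))"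
| "ecomp d (Mem a) = Seq (ecomp d a) (Load d d)"

definition bounded :: "nat \<Rightarrow> (nat \<Rightarrow> nat) \<Rightarrow> (nat \<Rightarrow> nat) \<Rightarrow> bool" where
  "bounded X v m \<longleftrightarrow> 2 \<le> X \<and> (\<forall>i. v i \<le> X) \<and> (\<forall>a. m a \<le> X)"

definition lift :: "(nat \<Rightarrow> nat) \<Rightarrow> nat \<Rightarrow> rat" where
  "lift m = (\<lambda>a. of_nat (m a))"

text \<open>Registers from 10 on hold intermediate values of expressions.\<close>

definition agree :: "(nat \<Rightarrow> nat) \<Rightarrow> (nat \<Rightarrow> rat) \<Rightarrow> bool" where
  "agree v R \<longleftrightarrow> (\<forall>i<10. R i = of_nat (v i))"

text \<open>A bound linear in the value instead of its logarithm is enough, because all values that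
  occur are polynomial in the size of the instance.\<close>

lemma rat_bits_of_nat: "rat_bits (of_nat a) \<le> a + 3"
proof -
  have q: "quotient_of (of_nat a) = (int a, 1)"
    using quotient_of_int[of "int a"] by simp
  have "floorlog 2 a \<le> a" by (simp add: floorlog_le_iff)
  moreover have "floorlog 2 (Suc 0) \<le> 2" by (simp add: floorlog_le_iff)
  ultimately show ?thesis by (simp add: rat_bits_def q)
qed

lemma rat_bits_le: "a \<le> b \<Longrightarrow> rat_bits (of_nat a) \<le> b + 3"
  using rat_bits_of_nat[of a] by simp

lemma eval_le:
  assumes "bounded X v m"
  shows "eval v m e \<le> X ^ edeg e"
proof (induction e)
  case (Const c)
  have "c \<le> 2 ^ c" by (simp add: less_imp_le)
  also have "\<dots> \<le> X ^ c" using assms by (intro power_mono) (auto simp: bounded_def)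
  finally show ?case by simp
next
  case (Plus a b)
  have 1: "1 \<le> X ^ edeg a" "1 \<le> X ^ edeg b" using assms by (auto simp: bounded_def)
  have "eval v m (Plus a b) \<le> X ^ edeg a + X ^ edeg b" using Plus by simp
  also have "\<dots> \<le> 2 * (X ^ edeg a * X ^ edeg b)"
    using mult_le_mono2[OF 1(2), of "X ^ edeg a"] mult_le_mono1[OF 1(1), of "X ^ edeg b"]
    unfolding mult_1_left mult_1_right by linarith
  also have "\<dots> \<le> X * (X ^ edeg a * X ^ edeg b)"
    using assms by (intro mult_right_mono) (auto simp: bounded_def)
  finally show ?case by (simp add: power_add)
next
  case (Times a b)
  then show ?case by (simp add: power_add mult_mono)
next
  case (Mem a)
  have "X ^ 1 \<le> X ^ (edeg a + 1)" using assms by (intro power_increasing) (auto simp: bounded_def)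
  moreover have "m (eval v m a) \<le> X" using assms by (auto simp: bounded_def)
  ultimately have "m (eval v m a) \<le> X ^ (edeg a + 1)" by (metis order_trans power_one_right)
  then show ?case by simp
qed (use assms in \<open>auto simp: bounded_def\<close>)

section \<open>Resource bounds for instructions and expressions\<close>

definition computes :: "prog \<Rightarrow> state \<Rightarrow> nat \<Rightarrow> nat \<Rightarrow> state \<Rightarrow> bool" where
  "computes c s T B s' \<longleftrightarrow> (\<exists>t b. exec c s t b s' \<and> t \<le> T \<and> b \<le> B)"

lemma computesI: "exec c s t b s' \<Longrightarrow> t \<le> T \<Longrightarrow> b \<le> B \<Longrightarrow> computes c s T B s'"
  unfolding computes_def by blast

lemma computes_mono: "computes c s T B s' \<Longrightarrow> T \<le> T' \<Longrightarrow> B \<le> B' \<Longrightarrow> computes c s T' B' s'"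
  unfolding computes_def by (meson order_trans)

lemma computes_Seq:
  "computes c1 s T1 B s1 \<Longrightarrow> computes c2 s1 T2 B s2 \<Longrightarrow> T1 + T2 \<le> T \<Longrightarrow> computes (Seq c1 c2) s T B s2"
proof -
  assume "computes c1 s T1 B s1" "computes c2 s1 T2 B s2" and T: "T1 + T2 \<le> T"
  then obtain t1 b1 t2 b2 where 1: "exec c1 s t1 b1 s1" "exec c2 s1 t2 b2 s2"
    and "t1 \<le> T1" "b1 \<le> B" "t2 \<le> T2" "b2 \<le> B" unfolding computes_def by blast
  then show ?thesis using T by (intro computesI[OF exec.Seq[OF 1]]) auto
qed

lemma computes_LoadConst:
  "a \<le> B \<Longrightarrow> computes (LoadConst i (of_nat a)) (R, M) 1 (B + 3) (R(i := of_nat a), M)"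
  by (rule computesI[OF exec.LoadConst]) (auto intro: rat_bits_le)

lemma computes_LoadConst_0: "computes (LoadConst i 0) (R, M) 1 (B + 3) (R(i := 0), M)"
  using computes_LoadConst[of 0 B i R M] by simp

lemma computes_Add:
  assumes "R j = of_nat a" "R k = of_nat b" "a + b \<le> B"
  shows "computes (Arith Add i j k) (R, M) 1 (B + 3) (R(i := of_nat (a + b)), M)"
  by (rule computesI[OF exec.Arith]) (use assms rat_bits_le[OF assms(3)] in auto)

lemma computes_Multiply:
  assumes "R j = of_nat a" "R k = of_nat b" "a * b \<le> B"
  shows "computes (Arith Multiply i j k) (R, M) 1 (B + 3) (R(i := of_nat (a * b)), M)"
  by (rule computesI[OF exec.Arith]) (use assms rat_bits_le[OF assms(3)] in auto)

lemma computes_Load: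
  assumes "R j = of_nat a" "m a \<le> B"
  shows "computes (Load i j) (R, lift m) 1 (B + 3) (R(i := of_nat (m a)), lift m)"
  using computesI[OF exec.Load[where R = R and j = j and a = a and i = i and M = "lift m"], of 1 "B + 3"] rat_bits_le[OF assms(2)] assms(1)
  by (simp add: lift_def)

lemma computes_Store:
  assumes "R i = of_nat a" "R j = of_nat b" "b \<le> B"
  shows "computes (Store i j) (R, lift m) 1 (B + 3) (R, lift (m(a := b)))"
proof -
  have "lift (m(a := b)) = (lift m)(a := R j)"
    using assms by (auto simp: lift_def)
  then show ?thesis
    using computesI[OF exec.Store[where R = R and i = i and a = a and j = j and M = "lift m"], of 1 "B + 3"] assms
      rat_bits_le[OF assms(3)] by auto
qed

text \<open>The registers from \<open>d\<close> on act as an evaluation stack. That registers below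
  \<open>d\<close> are preserved keeps the program variables intact, and it keeps the first operand
  in \<open>d\<close> while the second one is evaluated into \<open>Suc d\<close>.\<close>

lemma ecomp_computes:
  assumes "bounded X v m" "vars e \<subseteq> {..<10}" "agree v R" "10 \<le> d"
  shows "\<exists>R'. computes (ecomp d e) (R, lift m) (etime e) (X ^ edeg e + 3) (R', lift m) \<and>
    R' d = of_nat (eval v m e) \<and> (\<forall>i<d. R' i = R i)"
  using assms(2-4)
proof (induction e arbitrary: d R)
  case (Const c)
  have "c \<le> X ^ c" using eval_le[OF assms(1), of "Const c"] by simp
  then show ?case
    using computes_LoadConst[of c "X ^ c" d R "lift m"]
    by (intro exI[of _ "R(d := of_nat c)"] conjI) (simp_all del: fun_upd_apply, auto)
next
  case (Var x)
  have "v x \<le> X" using assms(1) by (simp add: bounded_def)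
  then have "computes (ecomp d (Var x)) (R, lift m) 2 (X + 3)
     (R(d := 0, d := of_nat (0 + v x)), lift m)"
    unfolding ecomp.simps
    using Var
    by (intro computes_Seq[OF computes_LoadConst_0 computes_Add]) (auto simp: agree_def)
  then show ?case by (intro exI) (auto)
next
  case (Plus a b)
  let ?B = "X ^ edeg (Plus a b)"
  have X: "1 \<le> X" using assms(1) by (simp add: bounded_def)
  from Plus.IH(1)[of R d] Plus.prems obtain R1 where
    1: "computes (ecomp d a) (R, lift m) (etime a) (X ^ edeg a + 3) (R1, lift m)"
      "R1 d = of_nat (eval v m a)" "\<forall>i<d. R1 i = R i" by auto
  have "agree v R1" using 1 Plus.prems by (auto simp: agree_def)
  with Plus.IH(2)[of R1 "Suc d"] Plus.prems obtain R2 where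
    2: "computes (ecomp (Suc d) b) (R1, lift m) (etime b) (X ^ edeg b + 3) (R2, lift m)"
      "R2 (Suc d) = of_nat (eval v m b)" "\<forall>i<Suc d. R2 i = R1 i" by auto
  have le: "X ^ edeg a \<le> ?B" "X ^ edeg b \<le> ?B" using X by (auto intro!: power_increasing simp del: power_Suc)
  have "computes (ecomp d (Plus a b)) (R, lift m) (etime (Plus a b)) (?B + 3)
     (R2(d := of_nat (eval v m a + eval v m b)), lift m)"
    unfolding ecomp.simps
    using 1 2 le eval_le[OF assms(1), of "Plus a b"]
    by (intro computes_Seq[OF computes_Seq[OF computes_mono[OF 1(1) order_refl]
        computes_mono[OF 2(1) order_refl] order_refl] computes_Add]) (auto simp del: of_nat_add of_nat_mult)
  then show ?case using 1 2 by (intro exI conjI) (assumption, auto)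
next
  case (Times a b)
  let ?B = "X ^ edeg (Times a b)"
  have X: "1 \<le> X" using assms(1) by (simp add: bounded_def)
  from Times.IH(1)[of R d] Times.prems obtain R1 where
    1: "computes (ecomp d a) (R, lift m) (etime a) (X ^ edeg a + 3) (R1, lift m)"
      "R1 d = of_nat (eval v m a)" "\<forall>i<d. R1 i = R i" by auto
  have "agree v R1" using 1 Times.prems by (auto simp: agree_def)
  with Times.IH(2)[of R1 "Suc d"] Times.prems obtain R2 where
    2: "computes (ecomp (Suc d) b) (R1, lift m) (etime b) (X ^ edeg b + 3) (R2, lift m)"
      "R2 (Suc d) = of_nat (eval v m b)" "\<forall>i<Suc d. R2 i = R1 i" by auto
  have le: "X ^ edeg a \<le> ?B" "X ^ edeg b \<le> ?B" using X by (auto intro!: power_increasing simp del: power_Suc)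
  have "computes (ecomp d (Times a b)) (R, lift m) (etime (Times a b)) (?B + 3)
     (R2(d := of_nat (eval v m a * eval v m b)), lift m)"
    unfolding ecomp.simps
    using 1 2 le eval_le[OF assms(1), of "Times a b"]
    by (intro computes_Seq[OF computes_Seq[OF computes_mono[OF 1(1) order_refl]
        computes_mono[OF 2(1) order_refl] order_refl] computes_Multiply]) (auto simp del: of_nat_add of_nat_mult)
  then show ?case using 1 2 by (intro exI conjI) (assumption, auto)
next
  case (Mem a)
  let ?B = "X ^ edeg (Mem a)"
  have X: "1 \<le> X" using assms(1) by (simp add: bounded_def)
  from Mem.IH[of R d] Mem.prems obtain R1 where
    1: "computes (ecomp d a) (R, lift m) (etime a) (X ^ edeg a + 3) (R1, lift m)"
      "R1 d = of_nat (eval v m a)" "\<forall>i<d. R1 i = R i" by auto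
  have le: "X ^ edeg a \<le> ?B" using X by (auto intro!: power_increasing simp del: power_Suc)
  have "computes (ecomp d (Mem a)) (R, lift m) (etime (Mem a)) (?B + 3)
     (R1(d := of_nat (m (eval v m a))), lift m)"
    unfolding ecomp.simps
    using 1 le eval_le[OF assms(1), of "Mem a"]
    by (intro computes_Seq[OF computes_mono[OF 1(1) order_refl] computes_Load]) auto
  then show ?case using 1 by (intro exI conjI) (assumption, auto)
qed

section \<open>Commands and a Hoare logic with resource bounds\<close>

datatype com =
    Assign nat exp
  | Write exp exp
  | Then com com
  | Cond exp exp com com
  | For nat nat com
  | Skip

text \<open>The machine can only test \<open>\<le>\<close>, so register 10 holds \<open>x + 1\<close> whenever a loop tests \<open>x < y\<close>.\<close>

primrec compile :: "com \<Rightarrow> prog" where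
  "compile (Assign x e) = Seq (ecomp 10 e) (Seq (LoadConst x 0) (Arith Add x x 10))"
| "compile (Write a e) = Seq (ecomp 10 a) (Seq (ecomp 11 e) (Store 10 11))"
| "compile (Then c1 c2) = Seq (compile c1) (compile c2)"
| "compile (Cond a b c1 c2) = Seq (ecomp 10 a) (Seq (ecomp 11 b) (IfLe 10 11 (compile c1) (compile c2)))"
| "compile (For x y c) =
    Seq (Seq (LoadConst x 0) (ecomp 10 (Plus (Var x) (Const 1))))
      (WhileLe 10 y (Seq (compile c)
        (Seq (Seq (ecomp 10 (Plus (Var x) (Const 1))) (Seq (LoadConst x 0) (Arith Add x x 10)))
          (ecomp 10 (Plus (Var x) (Const 1))))))"
| "compile Skip = LoadConst 10 0"

text \<open>Adding degrees is a crude way to dominate each of them. The extra 1 of an assignment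
  covers the copied value, which may be \<open>X\<close> even if the expression has degree 0. The 4
  of a loop is the degree of the assignment of \<open>Plus (Var x) (Const 1)\<close>, an expression
  of degree 3.\<close>

primrec cdeg :: "com \<Rightarrow> nat" where
  "cdeg (Assign x e) = edeg e + 1"
| "cdeg (Write a e) = edeg a + edeg e"
| "cdeg (Then c1 c2) = cdeg c1 + cdeg c2"
| "cdeg (Cond a b c1 c2) = edeg a + edeg b + cdeg c1 + cdeg c2"
| "cdeg (For x y c) = cdeg c + 4"
| "cdeg Skip = 0"

text \<open>The argument of the polynomial is a bound on the values of variables, hence also on the number
  of iterations of every loop.\<close>

primrec ctime :: "com \<Rightarrow> nat poly" where
  "ctime (Assign x e) = [:etime e + 2:]"
| "ctime (Write a e) = [:etime a + etime e + 1:]"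
| "ctime (Then c1 c2) = ctime c1 + ctime c2"
| "ctime (Cond a b c1 c2) = [:etime a + etime b + 1:] + ctime c1 + ctime c2"
| "ctime (For x y c) = [:6:] + [:0, 1:] * (ctime c + [:11:])"
| "ctime Skip = 1"

definition outcome ::
    "nat \<Rightarrow> com \<Rightarrow> (nat \<Rightarrow> rat) \<Rightarrow> (nat \<Rightarrow> nat) \<Rightarrow> ((nat \<Rightarrow> nat) \<Rightarrow> (nat \<Rightarrow> nat) \<Rightarrow> bool) \<Rightarrow> bool" where
  "outcome X c R m Q \<longleftrightarrow>
     (\<exists>v' m' R'. computes (compile c) (R, lift m) (poly (ctime c) X) (X ^ cdeg c + 3) (R', lift m') \<and>
        bounded X v' m' \<and> agree v' R' \<and> Q v' m')"

lemma outcomeI: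
  "computes (compile c) (R, lift m) (poly (ctime c) X) (X ^ cdeg c + 3) (R', lift m') \<Longrightarrow>
   bounded X v' m' \<Longrightarrow> agree v' R' \<Longrightarrow> Q v' m' \<Longrightarrow> outcome X c R m Q"
  unfolding outcome_def by (intro exI conjI)

text \<open>Total correctness, with time and size fixed by the command and \<open>X\<close>.
  Preservation of \<open>bounded\<close> is part of \<open>outcome\<close>, so the only quantitative
  obligations in later proofs are bounds on assigned values.\<close>

definition hoare ::
    "nat \<Rightarrow> ((nat \<Rightarrow> nat) \<Rightarrow> (nat \<Rightarrow> nat) \<Rightarrow> bool) \<Rightarrow> com \<Rightarrow> ((nat \<Rightarrow> nat) \<Rightarrow> (nat \<Rightarrow> nat) \<Rightarrow> bool) \<Rightarrow> bool" where
  "hoare X P c Q \<longleftrightarrow>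
     (\<forall>v m R. bounded X v m \<longrightarrow> agree v R \<longrightarrow> P v m \<longrightarrow> outcome X c R m Q)"

lemma hoareD: "hoare X P c Q \<Longrightarrow> bounded X v m \<Longrightarrow> agree v R \<Longrightarrow> P v m \<Longrightarrow> outcome X c R m Q"
  unfolding hoare_def by blast

lemma outcomeE:
  assumes "outcome X c R m Q"
  obtains v' m' R' where
    "computes (compile c) (R, lift m) (poly (ctime c) X) (X ^ cdeg c + 3) (R', lift m')"
    "bounded X v' m'" "agree v' R'" "Q v' m'"
  using assms unfolding outcome_def by blast

lemma hoare_conseq:
  "hoare X P' c Q' \<Longrightarrow> (\<And>v m. P v m \<Longrightarrow> P' v m) \<Longrightarrow> (\<And>v m. Q' v m \<Longrightarrow> Q v m) \<Longrightarrow> hoare X P c Q"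
  unfolding hoare_def outcome_def by meson

text \<open>Names the initial state, for postconditions that refer to the memory before the
  command.\<close>

lemma hoare_ghost:
  "(\<And>v0 m0. bounded X v0 m0 \<Longrightarrow> P v0 m0 \<Longrightarrow> hoare X (\<lambda>v m. v = v0 \<and> m = m0) c Q) \<Longrightarrow> hoare X P c Q"
  unfolding hoare_def by blast

lemma bounded_power: "bounded X v m \<Longrightarrow> a \<le> b \<Longrightarrow> X ^ a \<le> X ^ b"
  by (rule power_increasing) (auto simp: bounded_def)

lemma hoare_Skip: "(\<And>v m. P v m \<Longrightarrow> Q v m) \<Longrightarrow> hoare X P Skip Q"
  unfolding hoare_def
proof (intro allI impI)
  fix v m R
  assume PQ: "\<And>v m. P v m \<Longrightarrow> Q v m" and b: "bounded X v m" "agree v R" "P v m"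
  have "computes (compile Skip) (R, lift m) (poly (ctime Skip) X) (X ^ cdeg Skip + 3) (R(10 := 0), lift m)"
    using computes_LoadConst_0[of 10 R "lift m" 1] by simp
  moreover have "agree v (R(10 := 0))" using b by (simp add: agree_def)
  ultimately show "outcome X Skip R m Q"
    by (rule outcomeI[where Q = Q, OF _ b(1) _ PQ[OF b(3)]])
qed

lemma hoare_Then:
  assumes "hoare X P c1 S" "hoare X S c2 Q"
  shows "hoare X P (Then c1 c2) Q"
  unfolding hoare_def
proof (intro allI impI)
  fix v m R
  assume b: "bounded X v m" "agree v R" "P v m"
  from hoareD[OF assms(1), OF b] obtain v1 m1 R1 where 
    1: "computes (compile c1) (R, lift m) (poly (ctime c1) X) (X ^ cdeg c1 + 3) (R1, lift m1)"
      "bounded X v1 m1" "agree v1 R1" "S v1 m1"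
    by (rule outcomeE)
  from hoareD[OF assms(2), OF 1(2-4)] obtain v2 m2 R2 where
    2: "computes (compile c2) (R1, lift m1) (poly (ctime c2) X) (X ^ cdeg c2 + 3) (R2, lift m2)"
      "bounded X v2 m2" "agree v2 R2" "Q v2 m2"
    by (rule outcomeE)
  have "X ^ cdeg c1 \<le> X ^ cdeg (Then c1 c2)" "X ^ cdeg c2 \<le> X ^ cdeg (Then c1 c2)"
    by (auto intro: bounded_power[OF b(1)])
  then have "computes (compile (Then c1 c2)) (R, lift m) (poly (ctime (Then c1 c2)) X)
    (X ^ cdeg (Then c1 c2) + 3) (R2, lift m2)"
    unfolding compile.simps
    by (intro computes_Seq[OF computes_mono[OF 1(1) order_refl] computes_mono[OF 2(1) order_refl]]) auto
  then show "outcome X (Then c1 c2) R m Q"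
    by (rule outcomeI[where Q = Q, OF _ 2(2-4)])
qed

lemma Assign_computes:
  assumes "bounded X v m" "agree v R" "vars e \<subseteq> {..<10}" "x < 10" "eval v m e \<le> X"
  shows "\<exists>R'. computes (Seq (ecomp 10 e) (Seq (LoadConst x 0) (Arith Add x x 10))) (R, lift m)
    (etime e + 2) (X ^ (edeg e + 1) + 3) (R', lift m) \<and> agree (v(x := eval v m e)) R'"
proof -
  from ecomp_computes[OF assms(1,3,2) order_refl] obtain R1 where
    1: "computes (ecomp 10 e) (R, lift m) (etime e) (X ^ edeg e + 3) (R1, lift m)"
      "R1 10 = of_nat (eval v m e)" "\<forall>i<10. R1 i = R i" by blast
  have X: "X ^ 1 \<le> X ^ (edeg e + 1)" by (intro bounded_power[OF assms(1)]) auto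
  have "computes (Seq (ecomp 10 e) (Seq (LoadConst x 0) (Arith Add x x 10))) (R, lift m)
    (etime e + 2) (X ^ (edeg e + 1) + 3) (R1(x := 0, x := of_nat (0 + eval v m e)), lift m)"
    using assms 1 X
    by (intro computes_Seq[OF computes_mono[OF 1(1) order_refl] computes_Seq[OF computes_LoadConst_0 computes_Add]])
       (auto intro: bounded_power[OF assms(1)] simp del: power_Suc)
  moreover have "agree (v(x := eval v m e)) (R1(x := 0, x := of_nat (0 + eval v m e)))"
    using 1 assms(2) by (auto simp: agree_def)
  ultimately show ?thesis by auto
qed

lemma hoare_Assign:
  assumes "vars e \<subseteq> {..<10}" "x < 10"
    and "\<And>v m. P v m \<Longrightarrow> bounded X v m \<Longrightarrow> eval v m e \<le> X \<and> Q (v(x := eval v m e)) m"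
  shows "hoare X P (Assign x e) Q"
  unfolding hoare_def
proof (intro allI impI)
  fix v m R
  assume b: "bounded X v m" "agree v R" "P v m"
  from Assign_computes[OF b(1,2) assms(1,2)] assms(3)[OF b(3,1)] obtain R' where
    "computes (compile (Assign x e)) (R, lift m) (etime e + 2) (X ^ (edeg e + 1) + 3) (R', lift m)"
    "agree (v(x := eval v m e)) R'" by auto
  moreover have "bounded X (v(x := eval v m e)) m" "Q (v(x := eval v m e)) m"
    using assms(3)[OF b(3,1)] b(1) by (auto simp: bounded_def)
  ultimately show "outcome X (Assign x e) R m Q"
    by (intro outcomeI[where Q = Q and v' = "v(x := eval v m e)"]) simp_all
qed

lemma ecomp2_computes:
  assumes "bounded X v m" "agree v R" "vars a \<subseteq> {..<10}" "vars e \<subseteq> {..<10}"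
  obtains R1 R2 where 
    "computes (ecomp 10 a) (R, lift m) (etime a) (X ^ edeg a + 3) (R1, lift m)"
    "computes (ecomp 11 e) (R1, lift m) (etime e) (X ^ edeg e + 3) (R2, lift m)"
    "R2 10 = of_nat (eval v m a)" "R2 11 = of_nat (eval v m e)" "agree v R2"
proof -
  from ecomp_computes[OF assms(1,3,2) order_refl] obtain R1 where
    1: "computes (ecomp 10 a) (R, lift m) (etime a) (X ^ edeg a + 3) (R1, lift m)"
      "R1 10 = of_nat (eval v m a)" "\<forall>i<10. R1 i = R i" by blast
  have "agree v R1" using 1 assms(2) by (auto simp: agree_def)
  from ecomp_computes[OF assms(1,4) this, of 11] obtain R2 where
    2: "computes (ecomp 11 e) (R1, lift m) (etime e) (X ^ edeg e + 3) (R2, lift m)"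
      "R2 11 = of_nat (eval v m e)" "\<forall>i<11. R2 i = R1 i" by auto
  then show ?thesis using that[OF 1(1) 2(1)] 1 2 \<open>agree v R1\<close> by (auto simp: agree_def)
qed

lemma hoare_Write:
  assumes "vars a \<subseteq> {..<10}" "vars e \<subseteq> {..<10}"
    and "\<And>v m. P v m \<Longrightarrow> bounded X v m \<Longrightarrow> eval v m e \<le> X \<and> Q v (m(eval v m a := eval v m e))"
  shows "hoare X P (Write a e) Q"
  unfolding hoare_def
proof (intro allI impI)
  fix v m R
  assume b: "bounded X v m" "agree v R" "P v m"
  obtain R1 R2 where 
    R: "computes (ecomp 10 a) (R, lift m) (etime a) (X ^ edeg a + 3) (R1, lift m)"
    "computes (ecomp 11 e) (R1, lift m) (etime e) (X ^ edeg e + 3) (R2, lift m)"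
    "R2 10 = of_nat (eval v m a)" "R2 11 = of_nat (eval v m e)" "agree v R2"
    using ecomp2_computes[OF b(1,2) assms(1,2)] by blast
  have le: "X ^ edeg a \<le> X ^ cdeg (Write a e)" "X ^ edeg e \<le> X ^ cdeg (Write a e)"
    by (auto intro: bounded_power[OF b(1)])
  have "computes (compile (Write a e)) (R, lift m) (poly (ctime (Write a e)) X)
     (X ^ cdeg (Write a e) + 3) (R2, lift (m(eval v m a := eval v m e)))"
    unfolding compile.simps
    using le eval_le[OF b(1), of e] 
    by (intro computes_Seq[OF computes_mono[OF R(1) order_refl]
       computes_Seq[OF computes_mono[OF R(2) order_refl] computes_Store[OF R(3,4)]]]) auto
  moreover have "bounded X v (m(eval v m a := eval v m e))" "Q v (m(eval v m a := eval v m e))"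
    using assms(3)[OF b(3,1)] b(1) by (auto simp: bounded_def)
  ultimately show "outcome X (Write a e) R m Q"
    using R(5) by (intro outcomeI[where Q = Q])
qed

lemma computes_IfLe:
  assumes "if fst s i \<le> fst s j then computes c1 s T B s' else computes c2 s T B s'"
  shows "computes (IfLe i j c1 c2) s (T + 1) B s'"
proof (cases "fst s i \<le> fst s j")
  case True
  then obtain t b where "exec c1 s t b s'" "t \<le> T" "b \<le> B" using assms by (auto simp: computes_def)
  then show ?thesis using True by (intro computesI[OF exec.IfTrue]) auto
next
  case False
  then obtain t b where "exec c2 s t b s'" "t \<le> T" "b \<le> B" using assms by (auto simp: computes_def)
  then show ?thesis using False by (intro computesI[OF exec.IfFalse]) auto
qed

lemma hoare_Cond:
  assumes "vars a \<subseteq> {..<10}" "vars e \<subseteq> {..<10}"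
    and h1: "hoare X (\<lambda>v m. P v m \<and> eval v m a \<le> eval v m e) c1 Q"
    and h2: "hoare X (\<lambda>v m. P v m \<and> \<not> eval v m a \<le> eval v m e) c2 Q"
  shows "hoare X P (Cond a e c1 c2) Q"
  unfolding hoare_def
proof (intro allI impI)
  fix v m R
  assume b: "bounded X v m" "agree v R" "P v m"
  let ?c = "Cond a e c1 c2"
  obtain R1 R2 where 
    R: "computes (ecomp 10 a) (R, lift m) (etime a) (X ^ edeg a + 3) (R1, lift m)"
    "computes (ecomp 11 e) (R1, lift m) (etime e) (X ^ edeg e + 3) (R2, lift m)"
    "R2 10 = of_nat (eval v m a)" "R2 11 = of_nat (eval v m e)" "agree v R2"
    using ecomp2_computes[OF b(1,2) assms(1,2)] by blast
  have le: "X ^ edeg a \<le> X ^ cdeg ?c" "X ^ edeg e \<le> X ^ cdeg ?c"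
      "X ^ cdeg c1 \<le> X ^ cdeg ?c" "X ^ cdeg c2 \<le> X ^ cdeg ?c"
    by (auto intro: bounded_power[OF b(1)])
  have "\<exists>v' m' R'. (if eval v m a \<le> eval v m e
       then computes (compile c1) (R2, lift m) (poly (ctime c1 + ctime c2) X) (X ^ cdeg ?c + 3) (R', lift m') 
       else computes (compile c2) (R2, lift m) (poly (ctime c1 + ctime c2) X) (X ^ cdeg ?c + 3) (R', lift m'))
     \<and> bounded X v' m' \<and> agree v' R' \<and> Q v' m'"
  proof (cases "eval v m a \<le> eval v m e")
    case True
    with b(3) have "outcome X c1 R2 m Q" by (intro hoareD[OF h1, OF b(1) R(5)]) simp
    then obtain v' m' R' where
      "computes (compile c1) (R2, lift m) (poly (ctime c1) X) (X ^ cdeg c1 + 3) (R', lift m')"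
      "bounded X v' m'" "agree v' R'" "Q v' m'" by (rule outcomeE)
    then show ?thesis using True le by (intro exI[of _ v'] exI[of _ m'] exI[of _ R']) (auto elim: computes_mono)
  next
    case False
    with b(3) have "outcome X c2 R2 m Q" by (intro hoareD[OF h2, OF b(1) R(5)]) simp
    then obtain v' m' R' where
      "computes (compile c2) (R2, lift m) (poly (ctime c2) X) (X ^ cdeg c2 + 3) (R', lift m')"
      "bounded X v' m'" "agree v' R'" "Q v' m'" by (rule outcomeE)
    then show ?thesis using False le by (intro exI[of _ v'] exI[of _ m'] exI[of _ R']) (auto elim: computes_mono)
  qed
  then obtain v' m' R' where 3: "(if fst (R2, lift m) 10 \<le> fst (R2, lift m) 11
       then computes (compile c1) (R2, lift m) (poly (ctime c1 + ctime c2) X) (X ^ cdeg ?c + 3) (R', lift m') 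
       else computes (compile c2) (R2, lift m) (poly (ctime c1 + ctime c2) X) (X ^ cdeg ?c + 3) (R', lift m'))"
     "bounded X v' m'" "agree v' R'" "Q v' m'" using R(3,4) by auto
  have "computes (compile ?c) (R, lift m) (poly (ctime ?c) X)
     (X ^ cdeg ?c + 3) (R', lift m')"
    unfolding compile.simps
    using le
    by (intro computes_Seq[OF computes_mono[OF R(1) order_refl]
       computes_Seq[OF computes_mono[OF R(2) order_refl] computes_IfLe[OF 3(1)]]]) auto
  then show "outcome X ?c R m Q"
    by (rule outcomeI[where Q = Q, OF _ 3(2-4)])
qed

lemma computes_WhileTrue:
  assumes "fst s i \<le> fst s j" "computes c s T1 B s1" "computes (WhileLe i j c) s1 T2 B s2"
    "T1 + T2 + 1 \<le> T"
  shows "computes (WhileLe i j c) s T B s2"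
proof -
  obtain t1 b1 t2 b2 where 1: "exec c s t1 b1 s1" "exec (WhileLe i j c) s1 t2 b2 s2"
    and "t1 \<le> T1" "b1 \<le> B" "t2 \<le> T2" "b2 \<le> B" using assms unfolding computes_def by blast
  then show ?thesis using assms(4) by (intro computesI[OF exec.WhileTrue[OF assms(1) 1]]) auto
qed

text \<open>The compiled loop resets and increments \<open>x\<close> outside the body, so the
  invariant must be insensitive to \<open>x\<close> (\<open>stable\<close>), and the body has to
  leave \<open>x\<close> and the limit \<open>y\<close> as they were. The number \<open>N\<close> of
  iterations is the value of a variable, hence at most \<open>X\<close>.\<close>

lemma hoare_For:
  assumes xy: "x < 10" "y < 10" "x \<noteq> y"
    and init: "\<And>v m. P v m \<Longrightarrow> v y = N \<and> I 0 (v(x := 0)) m"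
    and stable: "\<And>i v m a. I i v m \<Longrightarrow> I i (v(x := a)) m"
    and body: "\<And>i. i < N \<Longrightarrow> hoare X (\<lambda>v m. I i v m \<and> v x = i \<and> v y = N) c
      (\<lambda>v m. I (Suc i) v m \<and> v x = i \<and> v y = N)"
    and final: "\<And>v m. I N v m \<Longrightarrow> v y = N \<Longrightarrow> Q v m"
  shows "hoare X P (For x y c) Q"
  unfolding hoare_def
proof (intro allI impI)
  fix v m R
  assume b: "bounded X v m" "agree v R" "P v m"
  define B where "B = X ^ cdeg (For x y c) + 3"
  define e where "e = Plus (Var x) (Const 1)"
  define w where "w = WhileLe 10 y (Seq (compile c)
        (Seq (Seq (ecomp 10 e) (Seq (LoadConst x 0) (Arith Add x x 10))) (ecomp 10 e)))"
  \<comment> \<open>An iteration adds 11 operations to the body: 1 test, 6 to increment the counter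
    and 4 to refill register 10. The test is counted by the rule for the loop, whence
    \<open>T - 1\<close> for the rest.\<close>
  define T where "T = poly (ctime c) X + 11"
  have X: "2 \<le> X" using b(1) by (simp add: bounded_def)
  have B1: "X ^ edeg e + 3 \<le> B" and B2: "X ^ (edeg e + 1) + 3 \<le> B" and B3: "X ^ cdeg c + 3 \<le> B"
    using X by (auto simp: B_def e_def intro!: power_increasing simp del: power_Suc)
  have e: "vars e \<subseteq> {..<10}" "etime e = 4" "\<And>v m. eval v m e = v x + 1"
    using xy by (auto simp: e_def)
  have loop: "\<exists>v' m' R'. computes w (R, lift m) ((N - i) * T + 1) B (R', lift m') \<and>
      bounded X v' m' \<and> agree v' R' \<and> v' y = N \<and> I N v' m'"
    if "i \<le> N" "bounded X v m" "agree v R" "I i v m" "v x = i" "v y = N" "R 10 = of_nat (i + 1)" for i v m R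
    using that
  proof (induction "N - i" arbitrary: i v m R)
    case 0
    then have "i = N" by simp
    have "R y = of_nat N" using 0 xy by (simp add: agree_def)
    with 0 \<open>i = N\<close> have "exec w (R, lift m) 1 0 (R, lift m)"
      unfolding w_def by (intro exec.WhileFalse) simp
    then have "computes w (R, lift m) ((N - i) * T + 1) B (R, lift m)"
      by (rule computesI) auto
    then show ?case using 0 \<open>i = N\<close> by blast
  next
    case (Suc k)
    then have "i < N" by simp
    have Ry: "R y = of_nat N" using Suc.prems xy by (simp add: agree_def)
    have "outcome X c R m (\<lambda>v m. I (Suc i) v m \<and> v x = i \<and> v y = N)"
      using Suc.prems by (intro hoareD[OF body[OF \<open>i < N\<close>], OF Suc.prems(2,3)]) simp
    then obtain v1 m1 R1 where
      1: "computes (compile c) (R, lift m) (poly (ctime c) X) (X ^ cdeg c + 3) (R1, lift m1)"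
      "bounded X v1 m1" "agree v1 R1" "I (Suc i) v1 m1" "v1 x = i" "v1 y = N"
      by (rule outcomeE) blast
    \<comment> \<open>The incremented counter is at most \<open>N\<close>, so it respects the bound
      on variables.\<close>
    have "N \<le> X" using 1(2,6) by (auto simp: bounded_def)
    then have "v1 x + 1 \<le> X" using \<open>i < N\<close> 1 by simp
    then obtain R2 where 2: "computes (Seq (ecomp 10 e) (Seq (LoadConst x 0) (Arith Add x x 10))) (R1, lift m1)
        (etime e + 2) (X ^ (edeg e + 1) + 3) (R2, lift m1)" "agree (v1(x := Suc i)) R2"
      using Assign_computes[OF 1(2,3) e(1) xy(1)] e(3)[of v1 m1] 1(5) by auto
    have b2: "bounded X (v1(x := Suc i)) m1" using 1(2,5) \<open>v1 x + 1 \<le> X\<close> by (auto simp: bounded_def)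
    obtain R3 where 3: "computes (ecomp 10 e) (R2, lift m1) (etime e) (X ^ edeg e + 3) (R3, lift m1)"
      "R3 10 = of_nat (eval (v1(x := Suc i)) m1 e)" "\<forall>i<10. R3 i = R2 i"
      using ecomp_computes[OF b2 e(1) 2(2) order_refl] by blast
    have "R3 10 = of_nat (Suc i + 1)" using 3(2) e(3)[of "v1(x := Suc i)" m1] by simp
    moreover have "agree (v1(x := Suc i)) R3" using 2(2) 3(3) by (auto simp: agree_def)
    moreover have k: "k = N - Suc i" "(v1(x := Suc i)) y = N" using Suc.hyps(2) 1(6) xy by auto
    ultimately obtain v' m' R' where 4: "computes w (R3, lift m1) ((N - Suc i) * T + 1) B (R', lift m')"
      "bounded X v' m'" "agree v' R'" "v' y = N" "I N v' m'"
      using Suc.hyps(1)[of "Suc i" "v1(x := Suc i)" m1 R3] Suc_leI[OF \<open>i < N\<close>] b2 stable[OF 1(4)] by fastforce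
    have t: "(N - i) * T = (N - Suc i) * T + T" unfolding k(1)[symmetric] Suc.hyps(2)[symmetric] by simp
    have "computes (Seq (compile c) (Seq (Seq (ecomp 10 e) (Seq (LoadConst x 0) (Arith Add x x 10)))
        (ecomp 10 e))) (R, lift m) (T - 1) B (R3, lift m1)"
      by (rule computes_Seq[OF computes_mono[OF 1(1) order_refl B3]
         computes_Seq[OF computes_mono[OF 2(1) order_refl B2] computes_mono[OF 3(1) order_refl B1] order_refl]])
         (simp add: T_def e(2))
    moreover have "fst (R, lift m) 10 \<le> fst (R, lift m) y" using Suc.prems(7) \<open>i < N\<close> Ry by simp
    moreover have "T - 1 + ((N - Suc i) * T + 1) + 1 \<le> (N - i) * T + 1"
      unfolding t by (simp add: T_def)
    ultimately have "computes w (R, lift m) ((N - i) * T + 1) B (R', lift m')"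
      using 4(1) unfolding w_def by (blast intro: computes_WhileTrue)
    then show ?case using 4 by blast
  qed
  have b0: "bounded X (v(x := 0)) m" using b by (simp add: bounded_def)
  have a0: "agree (v(x := 0)) (R(x := 0))" using b by (simp add: agree_def)
  obtain R1 where 1: "computes (ecomp 10 e) (R(x := 0), lift m) (etime e) (X ^ edeg e + 3) (R1, lift m)"
      "R1 10 = of_nat (eval (v(x := 0)) m e)" "\<forall>i<10. R1 i = (R(x := 0)) i"
      using ecomp_computes[OF b0 e(1) a0 order_refl] by blast
  have "R1 10 = of_nat (0 + 1)" using 1(2) e(3)[of "v(x := 0)" m] by simp
  moreover have "agree (v(x := 0)) R1" using a0 1(3) by (auto simp: agree_def)
  ultimately obtain v' m' R' where 4: "computes w (R1, lift m) ((N - 0) * T + 1) B (R', lift m')"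
      "bounded X v' m'" "agree v' R'" "v' y = N" "I N v' m'"
    using loop[of 0 "v(x := 0)" m R1] b0 init[OF b(3)] xy by auto
  have "computes (LoadConst x 0) (R, lift m) 1 B (R(x := 0), lift m)"
    using computes_LoadConst_0[of x R "lift m" "B - 3"] by (simp add: B_def)
  then have "computes (compile (For x y c)) (R, lift m) ((1 + 4) + ((N - 0) * T + 1)) B (R', lift m')"
    using 4(1) computes_mono[OF 1(1) order_refl B1] e(2)
    unfolding compile.simps e_def[symmetric] w_def[symmetric]
    by (intro computes_Seq[OF computes_Seq]) (auto)
  moreover have "N * T \<le> X * T" using b(1) init[OF b(3)] by (auto simp: bounded_def)
  ultimately have "computes (compile (For x y c)) (R, lift m) (poly (ctime (For x y c)) X) B (R', lift m')"
    by (elim computes_mono) (auto simp: T_def)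
  then show "outcome X (For x y c) R m Q"
    unfolding B_def by (rule outcomeI[where Q = Q, OF _ 4(2,3) final[OF 4(5,4)]])
qed

section \<open>Generators of minimal solutions\<close>

lemma zero_sum_subset:
  assumes "comm_group G" "finite (carrier G)" "f \<in> M \<rightarrow> carrier G" "finite M" "card (carrier G) \<le> card M"
  obtains Z where "Z \<subseteq> M" "Z \<noteq> {}" "finprod G f Z = \<one>\<^bsub>G\<^esub>"
proof -
  interpret comm_group G by fact
  define g where "g = card (carrier G)"
  obtain h where h: "bij_betw h {..<card M} M"
    using ex_bij_betw_nat_finite[OF assms(4)] by (auto simp: lessThan_atLeast0)
  have img: "h ` A \<subseteq> M" if "A \<subseteq> {..<g}" for A
    using h that assms(5) unfolding bij_betw_def g_def by fastforce
  have inj: "inj_on h {..<g}"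
    using h assms(5) unfolding bij_betw_def g_def by (meson inj_on_subset lessThan_subset_iff)
  have fc: "f \<in> h ` A \<rightarrow> carrier G" if "A \<subseteq> {..<g}" for A using img[OF that] assms(3) by auto
  define p where "p j = finprod G f (h ` {..<j})" for j
  have "p ` {..g} \<subseteq> carrier G" unfolding p_def by (auto intro!: finprod_closed fc)
  then have "card (p ` {..g}) \<le> g" unfolding g_def using assms(2) by (rule card_mono[rotated])
  \<comment> \<open>Together with the empty product \<open>p 0\<close> there are
    \<open>g + 1\<close> partial products, but at most \<open>g\<close> values.\<close>
  then have "\<not> inj_on p {..g}" using card_image[of p "{..g}"] by auto
  then obtain i j where ij: "i < j" "j \<le> g" "p i = p j"
    unfolding inj_on_def by (metis atMost_iff linorder_neqE_nat)
  define Z where "Z = h ` {i..<j}"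
  have Zs: "{i..<j} \<subseteq> {..<g}" "{..<i} \<subseteq> {..<g}" using ij by auto
  have "{..<j} = {..<i} \<union> {i..<j}" using ij by auto
  then have "h ` {..<j} = h ` {..<i} \<union> Z" by (auto simp: Z_def)
  moreover have "h ` {..<i} \<inter> Z = {}"
    unfolding Z_def using inj_on_image_Int[OF inj Zs(2,1)] by auto
  ultimately have "p j = p i \<otimes>\<^bsub>G\<^esub> finprod G f Z"
    unfolding p_def Z_def using fc[OF Zs(1)] fc[OF Zs(2)] by (simp add: finprod_Un_disjoint)
  then have "finprod G f Z = \<one>\<^bsub>G\<^esub>"
    using ij(3) l_cancel_one'[of "p i" "finprod G f Z"]
      finprod_closed[OF fc[OF Zs(1)]] finprod_closed[OF fc[OF Zs(2)]]
    by (simp add: Z_def p_def)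
  moreover have "Z \<subseteq> M" "Z \<noteq> {}" using img[OF Zs(1)] ij by (auto simp: Z_def)
  ultimately show ?thesis using that by blast
qed

lemma lattice_of_rtrancl: "(u, v) \<in> E\<^sup>* \<Longrightarrow> X \<in> lattice_of N E \<Longrightarrow> v \<in> X \<Longrightarrow> u \<in> X"
  by (induction rule: converse_rtrancl_induct) (auto simp: lattice_of_def enters_def)

lemma few_generators:
  assumes "comm_group G" "finite (carrier G)" "finite N" "E \<subseteq> N \<times> N" "acyclic E"
    "f \<in> N \<rightarrow> carrier G" "X \<in> lattice_of N E"
  shows "\<exists>F Y. Y \<in> lattice_of N E \<and> finprod G f Y = finprod G f X \<and> F \<subseteq> N \<and>
    card F < card (carrier G) \<and> Y = {u. \<exists>v\<in>F. (u, v) \<in> E\<^sup>*}"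
  using assms(7)
proof (induction "card X" arbitrary: X rule: less_induct)
  case less
  interpret comm_group G by fact
  have XN: "X \<subseteq> N" and fX: "finite X" using less.prems assms(3) by (auto simp: lattice_of_def finite_subset)
  have fc: "f \<in> A \<rightarrow> carrier G" if "A \<subseteq> X" for A using that XN assms(6) by auto
  define M where "M = {v\<in>X. \<forall>w\<in>X. (v, w) \<notin> E}"
  have MX: "M \<subseteq> X" by (auto simp: M_def)
  have wf: "wf (E\<inverse>)"
    using assms(3-5) by (intro finite_acyclic_wf_converse) (auto intro: finite_subset)
  \<comment> \<open>A walk along arcs inside \<open>X\<close> cannot go on forever, and where it
    stops is a maximal element.\<close>
  have "\<exists>v\<in>M. (u, v) \<in> E\<^sup>*" if "u \<in> X" for u
    using wf that
  proof (induction u rule: wf_induct_rule)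
    case (less u)
    show ?case
    proof (cases "u \<in> M")
      case False
      then obtain w where "w \<in> X" "(u, w) \<in> E" using less.prems by (auto simp: M_def)
      then show ?thesis using less.IH[of w] by (meson converse_iff converse_rtrancl_into_rtrancl)
    qed auto
  qed
  then have gen: "X = {u. \<exists>v\<in>M. (u, v) \<in> E\<^sup>*}"
    using lattice_of_rtrancl[OF _ less.prems] MX by blast
  show ?case
  proof (cases "card M < card (carrier G)")
    case True
    then show ?thesis using gen less.prems MX XN by blast
  next
    case False
    then obtain Z where Z: "Z \<subseteq> M" "Z \<noteq> {}" "finprod G f Z = \<one>\<^bsub>G\<^esub>"
      using zero_sum_subset[OF assms(1,2) fc[OF MX]] finite_subset[OF MX fX] by (metis linorder_not_less)
    \<comment> \<open>Only an arc from \<open>Z\<close> to \<open>X - Z\<close> could newly enter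
      the set, but elements of \<open>M\<close> have no arcs into \<open>X\<close>.\<close>
    have "X - Z \<in> lattice_of N E"
      using less.prems Z(1) unfolding lattice_of_def enters_def M_def by fastforce
    moreover have "card (X - Z) < card X"
      using Z MX fX by (intro psubset_card_mono) auto
    moreover have "finprod G f (X - Z) = finprod G f X"
    proof -
      have "X = (X - Z) \<union> Z" using Z MX by auto
      then have "finprod G f X = finprod G f ((X - Z) \<union> Z)" by simp
      also have "\<dots> = finprod G f (X - Z) \<otimes>\<^bsub>G\<^esub> finprod G f Z"
        using fX Z(1) MX finite_subset[OF Z(1) finite_subset[OF MX fX]]
        by (intro finprod_Un_disjoint fc) auto
      finally show ?thesis using Z(3) fc[of "X - Z"] by simp
    qed
    ultimately show ?thesis using less.hyps[of "X - Z"] by simp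
  qed
qed

text \<open>The nodes of the complete \<open>n\<close>-ary tree are numbered level by level: the children of node \<open>i\<close> are
  \<open>i * n + 1, \<dots>, i * n + n\<close>.\<close>

fun item :: "nat \<Rightarrow> (nat \<Rightarrow> nat set) \<Rightarrow> nat \<Rightarrow> nat set" where
  "item n D 0 = {}"
| "item n D (Suc i) = item n D (i div n) \<union> D (i mod n)"

lemma item_child: "v < n \<Longrightarrow> item n D (Suc (i * n + v)) = item n D i \<union> D v"
  by (simp add: add.commute)

text \<open>Adding a generator \<open>v\<close> to the set with index \<open>i\<close> leads to the
  index \<open>i * n + v + 1\<close>, which is less than \<open>(i + 1) * (n + 1)\<close>. So every
  generator costs a factor \<open>n + 1\<close>.\<close>

lemma item_surj:
  assumes "finite F" "F \<subseteq> {..<n}"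
  shows "\<exists>i < (n + 1) ^ card F. item n D i = (\<Union>v\<in>F. D v)"
  using assms
proof (induction F)
  case empty
  then show ?case by auto
next
  case (insert v F)
  then obtain i where i: "i < (n + 1) ^ card F" "item n D i = (\<Union>v\<in>F. D v)" by auto
  have v: "v < n" using insert by auto
  have "Suc (i * n + v) < (i + 1) * (n + 1)" using v by simp
  also have "\<dots> \<le> (n + 1) ^ card F * (n + 1)" using i by (intro mult_right_mono) auto
  finally have "Suc (i * n + v) < (n + 1) ^ card (insert v F)" using insert by (simp add: mult.commute)
  then show ?case using i v item_child[of v n D i] by (intro exI[of _ "Suc (i * n + v)"]) auto
qed

lemma item_in_lattice:
  assumes "\<And>v. D v \<in> lattice_of N E"
  shows "item n D i \<in> lattice_of N E"
proof (induction i rule: less_induct)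
  case (less i)
  show ?case
  proof (cases i)
    case 0
    then show ?thesis by (simp add: lattice_of_def enters_def)
  next
    case (Suc j)
    then show ?thesis using less[of "j div n"] assms by (simp add: lattice_of_Un less_Suc_eq_le)
  qed
qed

text \<open>Principal ideals of the reachability order. The condition \<open>u < n\<close> discards
  the reflexive pair of a \<open>v\<close> outside the range, so that the set is in the lattice for
  every \<open>v\<close>.\<close>

definition down :: "nat \<Rightarrow> (nat \<times> nat) set \<Rightarrow> nat \<Rightarrow> nat set" where
  "down n E v = {u. u < n \<and> (u, v) \<in> E\<^sup>*}"

lemma down_in_lattice: "E \<subseteq> {..<n} \<times> {..<n} \<Longrightarrow> down n E v \<in> lattice_of {..<n} E"
  by (auto simp: down_def lattice_of_def enters_def intro: converse_rtrancl_into_rtrancl)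

section \<open>Reflexive transitive closure in stages\<close>

primrec warshall :: "nat rel \<Rightarrow> nat \<Rightarrow> nat rel" where
  "warshall A 0 = A"
| "warshall A (Suc k) = warshall A k \<union> {(i, j). (i, k) \<in> warshall A k \<and> (k, j) \<in> warshall A k}"

text \<open>Transitivity through every processed vertex takes the place of a statement on paths with
  inner vertices below \<open>k\<close>. In the step for \<open>m < k\<close> either half may be a
  detour over \<open>k\<close>; the induction hypothesis joins the pieces that meet in
  \<open>m\<close>, and one passage through \<open>k\<close> remains at most.\<close>

lemma warshall_trans:
  "m < k \<Longrightarrow> (i, m) \<in> warshall A k \<Longrightarrow> (m, j) \<in> warshall A k \<Longrightarrow> (i, j) \<in> warshall A k"
proof (induction k arbitrary: i j)
  case (Suc k)
  show ?case
  proof (cases "m = k")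
    case True
    then show ?thesis using Suc.prems by auto
  next
    case False
    then have "m < k" using Suc.prems by simp
    then show ?thesis using Suc.prems(2,3) Suc.IH[OF \<open>m < k\<close>] unfolding warshall.simps by blast
  qed
qed simp

lemma warshall_subset: "A \<subseteq> warshall A k"
  by (induction k) auto

lemma warshall_sound: "A \<subseteq> B \<Longrightarrow> trans B \<Longrightarrow> warshall A k \<subseteq> B"
  by (induction k) (auto dest: transD)

lemma warshall_rtrancl:
  assumes E: "E \<subseteq> {..<n} \<times> {..<n}" and "u < n" "v < n"
  shows "(u, v) \<in> warshall (E \<union> Id_on {..<n}) n \<longleftrightarrow> (u, v) \<in> E\<^sup>*"
proof
  assume *: "(u, v) \<in> warshall (E \<union> Id_on {..<n}) n"
  have "E \<union> Id_on {..<n} \<subseteq> E\<^sup>*" by auto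
  from subsetD[OF warshall_sound[OF this trans_rtrancl] *] show "(u, v) \<in> E\<^sup>*" .
next
  assume "(u, v) \<in> E\<^sup>*"
  then show "(u, v) \<in> warshall (E \<union> Id_on {..<n}) n"
  proof (induction rule: rtrancl_induct)
    case base
    show ?case by (rule subsetD[OF warshall_subset]) (use \<open>u < n\<close> in auto)
  next
    case (step y z)
    have "y < n" using E step.hyps by auto
    moreover have "(y, z) \<in> warshall (E \<union> Id_on {..<n}) n"
      by (rule subsetD[OF warshall_subset]) (use step.hyps in auto)
    ultimately show ?case by (rule warshall_trans[OF _ step.IH])
  qed
qed

section \<open>The enumeration algorithm\<close>

declare item.simps(2) [simp del]

text \<open>Memory layout, where variable 1 holds \<open>n\<close>: the adjacency matrix starts at address 1, the labels at \<open>n\<^sup>2 + 1\<close>, the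
  target is at \<open>n\<^sup>2 + n + 1\<close>, the group table starts at \<open>n\<^sup>2 + n + 2\<close>, and the items start behind
  it.\<close>

definition cell :: "nat \<Rightarrow> nat \<Rightarrow> exp" where
  "cell x y = Plus (Const 1) (Plus (Times (Var x) (Var 1)) (Var y))"

definition label_at :: "nat \<Rightarrow> exp" where
  "label_at x = Plus (Const 1) (Plus (Times (Var 1) (Var 1)) (Var x))"

definition table :: exp where
  "table = Plus (Const 2) (Plus (Times (Var 1) (Var 1)) (Var 1))"

definition item_at :: "nat \<Rightarrow> exp \<Rightarrow> nat \<Rightarrow> exp" where
  "item_at g i y = Plus (Plus table (Const (g * g))) (Plus (Times i (Var 1)) (Var y))"

definition table_addr :: "nat \<Rightarrow> nat" where
  "table_addr n = n * n + n + 2"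

definition item_addr :: "nat \<Rightarrow> nat \<Rightarrow> nat \<Rightarrow> nat \<Rightarrow> nat" where
  "item_addr n g i w = table_addr n + g * g + (i * n + w)"

lemma eval_address [simp]:
  "eval v m (cell x y) = Suc (v x * v 1 + v y)"
  "eval v m (label_at x) = Suc (v 1 * v 1 + v x)"
  "eval v m table = table_addr (v 1)"
  "eval v m (item_at g i y) = item_addr (v 1) g (eval v m i) (v y)"
  by (simp_all add: cell_def label_at_def table_def item_at_def table_addr_def item_addr_def)

lemma vars_address [simp]:
  "vars (cell x y) = {1, x, y}" "vars (label_at x) = {1, x}" "vars table = {1}"
  "vars (item_at g i y) = {1, y} \<union> vars i"
  by (auto simp: cell_def label_at_def table_def item_at_def)

lemma Suc_0_le_of_bool [simp]: "Suc 0 \<le> of_bool P \<longleftrightarrow> P"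
  by (cases P) auto

lemma row_col_le: "i < k \<Longrightarrow> j < n \<Longrightarrow> Suc (i * n + j) \<le> k * n"
  for i j k n :: nat
proof -
  assume "i < k" "j < n"
  then have "Suc (i * n + j) \<le> i * n + n" by simp
  also have "\<dots> = Suc i * n" by simp
  also have "\<dots> \<le> k * n" using \<open>i < k\<close> by (intro mult_right_mono) auto
  finally show ?thesis .
qed

lemma row_col_inj: "j < n \<Longrightarrow> j' < n \<Longrightarrow> i * n + j = i' * n + j' \<longleftrightarrow> i = i' \<and> j = j'"
  for i j i' j' n :: nat
proof
  assume "j < n" "j' < n" and eq: "i * n + j = i' * n + j'"
  from \<open>j < n\<close> \<open>j' < n\<close> have "i = (i * n + j) div n" "i' = (i' * n + j') div n" by simp_all
  with eq have "i = i'" by metis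
  then show "i = i' \<and> j = j'" using eq by simp
qed simp

text \<open>\<open>m0\<close> stands for the initial memory. The second conjunct is the frame that
  carries labels, target and the zeros behind them through the computation of reachability.\<close>

definition mat :: "nat \<Rightarrow> (nat \<Rightarrow> nat) \<Rightarrow> (nat \<Rightarrow> nat) \<Rightarrow> nat rel \<Rightarrow> bool" where
  "mat n m0 m A \<longleftrightarrow> (\<forall>u<n. \<forall>w<n. m (Suc (u * n + w)) = of_bool ((u, w) \<in> A)) \<and>
     (\<forall>a. a = 0 \<or> n * n < a \<longrightarrow> m a = m0 a)"

lemma mat_insert:
  assumes "mat n m0 m A" "i < n" "j < n"
  shows "mat n m0 (m(Suc (i * n + j) := 1)) (insert (i, j) A)"
  using assms row_col_le[OF assms(2,3)] by (auto simp: mat_def row_col_inj)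

lemma mat_cong:
  "mat n m0 m A \<Longrightarrow> (\<And>u w. u < n \<Longrightarrow> w < n \<Longrightarrow> (u, w) \<in> A \<longleftrightarrow> (u, w) \<in> B) \<Longrightarrow> mat n m0 m B"
  by (simp add: mat_def)

section \<open>Reachability computed in place\<close>

definition diag_com :: com where
  "diag_com = For 2 1 (Write (cell 2 2) (Const 1))"

lemma diag_com:
  assumes "1 \<le> X"
  shows "hoare X (\<lambda>v m. v 1 = n \<and> mat n m0 m A) diag_com (\<lambda>v m. v 1 = n \<and> mat n m0 m (A \<union> Id_on {..<n}))"
  unfolding diag_com_def
proof (rule hoare_For[where N = n and I = "\<lambda>i v m. v 1 = n \<and> mat n m0 m (A \<union> Id_on {..<i})"])
  fix i assume "i < n"
  show "hoare X (\<lambda>v m. (v 1 = n \<and> mat n m0 m (A \<union> Id_on {..<i})) \<and> v 2 = i \<and> v 1 = n)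
    (Write (cell 2 2) (Const 1))
    (\<lambda>v m. (v 1 = n \<and> mat n m0 m (A \<union> Id_on {..<Suc i})) \<and> v 2 = i \<and> v 1 = n)"
  proof (rule hoare_Write)
    fix v m :: "nat \<Rightarrow> nat"
    assume *: "(v 1 = n \<and> mat n m0 m (A \<union> Id_on {..<i})) \<and> v 2 = i \<and> v 1 = n"
    have "mat n m0 (m(Suc (i * n + i) := 1)) (A \<union> Id_on {..<Suc i})"
      by (rule mat_cong[OF mat_insert[of n m0 m "A \<union> Id_on {..<i}"]]) (use * \<open>i < n\<close> in auto)
    then show "eval v m (Const 1) \<le> X \<and> (v 1 = n \<and> mat n m0 (m(eval v m (cell 2 2) := eval v m (Const 1)))
      (A \<union> Id_on {..<Suc i})) \<and> v 2 = i \<and> v 1 = n" using * assms by simp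
  qed auto
qed auto

text \<open>The product of two 0/1 entries expresses the conjunction.\<close>

definition warshall_com :: com where
  "warshall_com = For 2 1 (For 3 1 (For 4 1
     (Cond (Const 1) (Times (Mem (cell 3 2)) (Mem (cell 2 4))) (Write (cell 3 4) (Const 1)) Skip)))"

lemma warshall_com:
  assumes "1 \<le> X"
  shows "hoare X (\<lambda>v m. v 1 = n \<and> mat n m0 m A) warshall_com (\<lambda>v m. v 1 = n \<and> mat n m0 m (warshall A n))"
  unfolding warshall_com_def
proof (rule hoare_For[where N = n and I = "\<lambda>k v m. v 1 = n \<and> mat n m0 m (warshall A k)"])
  fix k assume k: "k < n"
  \<comment> \<open>The matrix in the middle of a stage: positions before \<open>(i, j)\<close> in
    row order are already updated, the others are not.\<close>
  define W where "W i j = warshall A k \<union> {(u, w) \<in> warshall A (Suc k). u < i \<or> u = i \<and> w < j}" for i j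
  show "hoare X (\<lambda>v m. (v 1 = n \<and> mat n m0 m (warshall A k)) \<and> v 2 = k \<and> v 1 = n)
    (For 3 1 (For 4 1
     (Cond (Const 1) (Times (Mem (cell 3 2)) (Mem (cell 2 4))) (Write (cell 3 4) (Const 1)) Skip)))
    (\<lambda>v m. (v 1 = n \<and> mat n m0 m (warshall A (Suc k))) \<and> v 2 = k \<and> v 1 = n)"
  proof (rule hoare_For[where N = n and I = "\<lambda>i v m. v 1 = n \<and> v 2 = k \<and> mat n m0 m (W i 0)"])
    fix i assume i: "i < n"
    show "hoare X (\<lambda>v m. (v 1 = n \<and> v 2 = k \<and> mat n m0 m (W i 0)) \<and> v 3 = i \<and> v 1 = n)
      (For 4 1
       (Cond (Const 1) (Times (Mem (cell 3 2)) (Mem (cell 2 4))) (Write (cell 3 4) (Const 1)) Skip))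
      (\<lambda>v m. (v 1 = n \<and> v 2 = k \<and> mat n m0 m (W (Suc i) 0)) \<and> v 3 = i \<and> v 1 = n)"
    proof (rule hoare_For[where N = n and I = "\<lambda>j v m. v 1 = n \<and> v 2 = k \<and> v 3 = i \<and> mat n m0 m (W i j)"])
      fix j assume j: "j < n"
      let ?P = "\<lambda>(v :: nat \<Rightarrow> nat) m. (v 1 = n \<and> v 2 = k \<and> v 3 = i \<and> mat n m0 m (W i j)) \<and> v 4 = j \<and> v 1 = n"
      \<comment> \<open>Updating in place is harmless, since stage \<open>k\<close> changes neither
        row \<open>k\<close> nor column \<open>k\<close>: a new pair \<open>(i, k)\<close> would
        have to come from the old pair \<open>(i, k)\<close> itself, and likewise for
        \<open>(k, j)\<close>.\<close>
      have read: "m (Suc (i * n + k)) = of_bool ((i, k) \<in> warshall A k)"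
        "m (Suc (k * n + j)) = of_bool ((k, j) \<in> warshall A k)" if "mat n m0 m (W i j)" for m
        using that i j k by (auto simp: mat_def W_def)
      have upd: "(i, j) \<in> warshall A (Suc k) \<longleftrightarrow> (i, j) \<in> warshall A k \<or> (i, k) \<in> warshall A k \<and> (k, j) \<in> warshall A k"
        by auto
      show "hoare X ?P
        (Cond (Const 1) (Times (Mem (cell 3 2)) (Mem (cell 2 4))) (Write (cell 3 4) (Const 1)) Skip)
        (\<lambda>v m. (v 1 = n \<and> v 2 = k \<and> v 3 = i \<and> mat n m0 m (W i (Suc j))) \<and> v 4 = j \<and> v 1 = n)"
      proof (rule hoare_Cond[OF _ _ hoare_Write hoare_Skip])
        fix v m :: "nat \<Rightarrow> nat"
        assume *: "?P v m \<and> eval v m (Const 1) \<le> eval v m (Times (Mem (cell 3 2)) (Mem (cell 2 4)))"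
        then have "(i, j) \<in> warshall A (Suc k)"
          using read[of m] by auto
        then have "insert (i, j) (W i j) = W i (Suc j)" by (auto simp: W_def less_Suc_eq simp del: warshall.simps)
        then have "mat n m0 (m(Suc (i * n + j) := 1)) (W i (Suc j))"
          using mat_insert[of n m0 m "W i j" i j] * i j by simp
        then show "eval v m (Const 1) \<le> X \<and> (v 1 = n \<and> v 2 = k \<and> v 3 = i \<and>
           mat n m0 (m(eval v m (cell 3 4) := eval v m (Const 1))) (W i (Suc j))) \<and> v 4 = j \<and> v 1 = n"
          using * assms by simp
      next
        fix v m :: "nat \<Rightarrow> nat"
        assume *: "?P v m \<and> \<not> eval v m (Const 1) \<le> eval v m (Times (Mem (cell 3 2)) (Mem (cell 2 4)))"
        then have "(i, j) \<in> warshall A (Suc k) \<longleftrightarrow> (i, j) \<in> warshall A k"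
          using read[of m] upd by auto
        then have "W i j = W i (Suc j)" by (auto simp: W_def less_Suc_eq simp del: warshall.simps)
        then show "(v 1 = n \<and> v 2 = k \<and> v 3 = i \<and> mat n m0 m (W i (Suc j))) \<and> v 4 = j \<and> v 1 = n"
          using * by simp
      qed auto
    next
      fix v m :: "nat \<Rightarrow> nat"
      assume *: "v 1 = n \<and> v 2 = k \<and> v 3 = i \<and> mat n m0 m (W i n)" "v 1 = n"
      have "mat n m0 m (W (Suc i) 0)"
        by (rule mat_cong[of _ _ _ "W i n"]) (use * in \<open>auto simp: W_def less_Suc_eq simp del: warshall.simps\<close>)
      then show "(v 1 = n \<and> v 2 = k \<and> mat n m0 m (W (Suc i) 0)) \<and> v 3 = i \<and> v 1 = n"
        using * by simp
    qed auto
  next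
    fix v m :: "nat \<Rightarrow> nat"
    assume *: "v 1 = n \<and> v 2 = k \<and> mat n m0 m (W n 0)" "v 1 = n"
    have "mat n m0 m (warshall A (Suc k))"
      by (rule mat_cong[of _ _ _ "W n 0"]) (use * in \<open>auto simp: W_def\<close>)
    then show "(v 1 = n \<and> mat n m0 m (warshall A (Suc k))) \<and> v 2 = k \<and> v 1 = n"
      using * by simp
  qed (auto simp: W_def)
qed auto

text \<open>The recursion unrolls one write of a constant per entry. This is how the multiplication
  of the fixed group gets into the program text.\<close>

primrec table_com :: "(nat \<Rightarrow> nat) \<Rightarrow> nat \<Rightarrow> com" where
  "table_com f 0 = Skip"
| "table_com f (Suc q) = Then (table_com f q) (Write (Plus table (Const q)) (Const (f q)))"

lemma table_com:
  assumes "\<And>i. i < q \<Longrightarrow> f i \<le> X"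
  shows "hoare X (\<lambda>v m. v 1 = n \<and> m = m0) (table_com f q)
    (\<lambda>v m. v 1 = n \<and> (\<forall>i<q. m (table_addr n + i) = f i) \<and>
       (\<forall>a. a < table_addr n \<or> table_addr n + q \<le> a \<longrightarrow> m a = m0 a))"
  using assms
proof (induction q)
  case 0
  show ?case by (auto intro: hoare_Skip)
next
  case (Suc q)
  show ?case unfolding table_com.simps
    by (rule hoare_Then[OF Suc.IH hoare_Write]) (use Suc.prems in \<open>auto simp: less_Suc_eq\<close>)
qed

text \<open>Again unrolled, as the exponent will be the order of the group. Variable 5 becomes the
  number of tree nodes to be tested.\<close>

primrec power_com :: "nat \<Rightarrow> com" where
  "power_com 0 = Assign 5 (Const 1)"
| "power_com (Suc q) = Then (power_com q) (Assign 5 (Times (Var 5) (Plus (Var 1) (Const 1))))"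

lemma power_com:
  assumes "(n + 1) ^ q \<le> X"
  shows "hoare X (\<lambda>v m. v 1 = n \<and> P m) (power_com q) (\<lambda>v m. v 1 = n \<and> v 5 = (n + 1) ^ q \<and> P m)"
  using assms
proof (induction q)
  case 0
  show ?case unfolding power_com.simps by (rule hoare_Assign) (use 0 in auto)
next
  case (Suc q)
  have "(n + 1) ^ q \<le> (n + 1) ^ Suc q" by (rule power_increasing) auto
  then have "(n + 1) ^ q \<le> X" using Suc.prems by simp
  from Suc.IH[OF this] show ?case unfolding power_com.simps
    by (rule hoare_Then[OF _ hoare_Assign]) (use Suc.prems in \<open>auto simp: algebra_simps\<close>)
qed

text \<open>Group elements are given by their codes: \<open>f\<close> is the multiplication, \<open>a\<close> the unit, and \<open>l\<close> the
  labelling.\<close>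

primrec partial :: "(nat \<Rightarrow> nat \<Rightarrow> nat) \<Rightarrow> nat \<Rightarrow> (nat \<Rightarrow> nat) \<Rightarrow> nat set \<Rightarrow> nat \<Rightarrow> nat" where
  "partial f a l T 0 = a"
| "partial f a l T (Suc j) = (if j \<in> T then f (partial f a l T j) (l j) else partial f a l T j)"

text \<open>The search is verified for mere codes: \<open>f\<close> only has to stay below
  \<open>g\<close>, and no group law is assumed. The relation \<open>R\<close> will be
  reachability.\<close>

locale enumeration =
  fixes X n g a tgt :: nat and f :: "nat \<Rightarrow> nat \<Rightarrow> nat" and l :: "nat \<Rightarrow> nat" and R :: "nat rel"
  assumes X: "2 \<le> X" "n + 1 \<le> X" "a \<le> X"
    and a: "a < g" and l: "\<And>w. w < n \<Longrightarrow> l w < g" and f: "\<And>x y. x < g \<Longrightarrow> y < g \<Longrightarrow> f x y < g"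
begin

section \<open>Generating, testing and reporting the sets\<close>

definition D :: "nat \<Rightarrow> nat set" where
  "D v = {w. w < n \<and> (w, v) \<in> R}"

abbreviation S :: "nat \<Rightarrow> nat set" where
  "S \<equiv> item n D"

definition input :: "(nat \<Rightarrow> nat) \<Rightarrow> bool" where
  "input m \<longleftrightarrow> (\<forall>u<n. \<forall>w<n. m (Suc (u * n + w)) = of_bool ((u, w) \<in> R)) \<and>
     (\<forall>w<n. m (Suc (n * n + w)) = l w) \<and> m (Suc (n * n + n)) = tgt \<and>
     (\<forall>x<g. \<forall>y<g. m (table_addr n + (x * g + y)) = f x y)"

definition items :: "(nat \<Rightarrow> nat) \<Rightarrow> nat \<Rightarrow> bool" where
  "items m c \<longleftrightarrow> (\<forall>i\<le>c. \<forall>w<n. m (item_addr n g i w) = of_bool (w \<in> S i))"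

text \<open>Variable 8 is the flag for success, and then variable 7 is the index of a solution.\<close>

definition found :: "nat \<Rightarrow> (nat \<Rightarrow> nat) \<Rightarrow> bool" where
  "found i v \<longleftrightarrow> v 8 = 0 \<and> (\<forall>i'<i. partial f a l (S i') n \<noteq> tgt) \<or>
     v 8 = 1 \<and> v 7 < i \<and> partial f a l (S (v 7)) n = tgt"

lemma partial_less: "j \<le> n \<Longrightarrow> partial f a l T j < g"
  by (induction j) (auto simp: a l f)

lemma input_write: 
  assumes "input m" shows "input (m(item_addr n g i w := b))"
proof -
  have 1: "Suc (u * n + w) < item_addr n g i w'" if "u < n" "w < n" for u w w'
    using row_col_le[OF that] by (simp add: item_addr_def table_addr_def)
  have 2: "x * g + y < g * g" if "x < g" "y < g" for x y
    using row_col_le[OF that] by simp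
  have 3: "table_addr n + (x * g + y) \<noteq> item_addr n g i w" if "x < g" "y < g" for x y
    using 2[OF that] by (simp add: item_addr_def)
  show ?thesis using assms 1 3 unfolding input_def
    by (auto simp: item_addr_def table_addr_def dest: less_imp_neq)
qed

definition product_com :: com where
  "product_com = Then (Assign 6 (Const a)) (For 3 1 (Cond (Const 1) (Mem (item_at g (Var 2) 3))
     (Assign 6 (Mem (Plus table (Plus (Times (Var 6) (Const g)) (Mem (label_at 3)))))) Skip))"

text \<open>The invariant of the search: \<open>K\<close> is the loop limit, \<open>k\<close> the
  number of items tested, \<open>c\<close> the index of the last item written. The latter two
  advance separately because item \<open>i\<close> is tested before its \<open>n\<close> children
  are written.\<close>

definition good :: "nat \<Rightarrow> nat \<Rightarrow> nat \<Rightarrow> (nat \<Rightarrow> nat) \<Rightarrow> (nat \<Rightarrow> nat) \<Rightarrow> bool" where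
  "good K k c v m \<longleftrightarrow> v 1 = n \<and> v 5 = K \<and> found k v \<and> input m \<and> items m c"

lemma good_upd [simp]: "x \<notin> {1, 5, 7, 8} \<Longrightarrow> good K k c (v(x := b)) m \<longleftrightarrow> good K k c v m"
  by (auto simp: good_def found_def)

lemma good_vars: "good K k c v m \<Longrightarrow> v (Suc 0) = n" "good K k c v m \<Longrightarrow> v 5 = K"
  by (simp_all add: good_def)

lemma product_com:
  "hoare X (\<lambda>v m. good K i (i * n) v m \<and> v 2 = i) product_com
     (\<lambda>v m. good K i (i * n) v m \<and> v 2 = i \<and> v 6 = partial f a l (S i) n)"
  unfolding product_com_def
proof (rule hoare_Then)
  let ?I = "\<lambda>j v m. good K i (i * n) v m \<and> v 2 = i \<and> v 6 = partial f a l (S i) j"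
  show "hoare X (\<lambda>v m. good K i (i * n) v m \<and> v 2 = i) (Assign 6 (Const a)) (?I 0)"
    by (rule hoare_Assign) (use X in auto)
  show "hoare X (?I 0) (For 3 1 (Cond (Const 1) (Mem (item_at g (Var 2) 3))
     (Assign 6 (Mem (Plus table (Plus (Times (Var 6) (Const g)) (Mem (label_at 3)))))) Skip)) (?I n)"
  proof (rule hoare_For[where N = n and I = ?I])
    fix j assume j: "j < n"
    let ?P = "\<lambda>(v :: nat \<Rightarrow> nat) m. ?I j v m \<and> v 3 = j \<and> v 1 = n"
    \<comment> \<open>Item \<open>i\<close> is already in memory: the items up to
      \<open>i * n\<close> are written, and \<open>n\<close> is positive because of
      \<open>j < n\<close>.\<close>
    have ij: "i \<le> i * n" using j by (cases n) auto
    have read: "m (item_addr n g i j) = of_bool (j \<in> S i)" if "good K i (i * n) v m" for v m :: "nat \<Rightarrow> nat"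
      using that ij j by (auto simp: good_def items_def)
    show "hoare X ?P (Cond (Const 1) (Mem (item_at g (Var 2) 3))
      (Assign 6 (Mem (Plus table (Plus (Times (Var 6) (Const g)) (Mem (label_at 3)))))) Skip)
      (\<lambda>v m. ?I (Suc j) v m \<and> v 3 = j \<and> v 1 = n)"
    proof (rule hoare_Cond[OF _ _ hoare_Assign hoare_Skip])
      fix v m :: "nat \<Rightarrow> nat"
      assume *: "?P v m \<and> eval v m (Const 1) \<le> eval v m (Mem (item_at g (Var 2) 3))" and b: "bounded X v m"
      let ?e = "Mem (Plus table (Plus (Times (Var 6) (Const g)) (Mem (label_at 3))))"
      have "j \<in> S i" using * read[of v m] by auto
      have "m (Suc (n * n + j)) = l j" using * j by (auto simp: good_def input_def)
      then have e: "eval v m ?e = m (table_addr n + (partial f a l (S i) j * g + l j))" using * by simp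
      also have "\<dots> = f (partial f a l (S i) j) (l j)"
        using * partial_less[of j "S i"] l[OF j] j by (auto simp: good_def input_def)
      also have "\<dots> = partial f a l (S i) (Suc j)" using \<open>j \<in> S i\<close> by simp
      finally have e': "eval v m ?e = partial f a l (S i) (Suc j)" .
      have "eval v m ?e \<le> X" using b unfolding e by (simp add: bounded_def)
      then show "eval v m ?e \<le> X \<and> ?I (Suc j) (v(6 := eval v m ?e)) m \<and>
          (v(6 := eval v m ?e)) 3 = j \<and> (v(6 := eval v m ?e)) 1 = n"
        unfolding e' using * by simp
    next
      fix v m :: "nat \<Rightarrow> nat"
      assume *: "?P v m \<and> \<not> eval v m (Const 1) \<le> eval v m (Mem (item_at g (Var 2) 3))"
      then have "j \<notin> S i" using read[of v m] by auto
      then show "?I (Suc j) v m \<and> v 3 = j \<and> v 1 = n" using * by simp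
    qed auto
  qed (simp_all, ((elim conjE)?, erule good_vars)?)
qed

text \<open>\<open>label_at 1\<close> addresses the target: variable 1 holds \<open>n\<close>, and
  the target follows the labels with positions below \<open>n\<close>. Equality is tested by two
  comparisons.\<close>

definition check_com :: com where
  "check_com = Cond (Var 6) (Mem (label_at 1)) (Cond (Mem (label_at 1)) (Var 6)
     (Then (Assign 7 (Var 2)) (Assign 8 (Const 1))) Skip) Skip"

lemma check_com:
  "hoare X (\<lambda>v m. good K i (i * n) v m \<and> v 2 = i \<and> v 6 = partial f a l (S i) n) check_com
     (\<lambda>v m. good K (Suc i) (i * n) v m \<and> v 2 = i)"
proof -
  have t: "m (Suc (n * n + n)) = tgt" if "good K i (i * n) v m" for v m :: "nat \<Rightarrow> nat"
    using that by (simp add: good_def input_def)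
  let ?P = "\<lambda>(v :: nat \<Rightarrow> nat) m. good K i (i * n) v m \<and> v 2 = i \<and> v 6 = partial f a l (S i) n"
  let ?Q = "\<lambda>(v :: nat \<Rightarrow> nat) m. good K (Suc i) (i * n) v m \<and> v 2 = i"
  have neq: "?Q v m" if "?P v m" "v 6 \<noteq> tgt" for v m :: "nat \<Rightarrow> nat"
    using that by (auto simp: good_def found_def less_Suc_eq)
  have eq: "?Q (v(7 := i, 8 := 1)) m" if "?P v m" "v 6 = tgt" for v m :: "nat \<Rightarrow> nat"
  proof -
    have "partial f a l (S i) n = tgt" "good K i (i * n) v m" "v 2 = i" using that by metis+
    then show ?thesis unfolding good_def found_def by simp
  qed
  show ?thesis
    unfolding check_com_def
  proof (rule hoare_Cond[OF _ _ hoare_Cond[OF _ _ hoare_Then[OF hoare_Assign hoare_Assign] hoare_Skip] hoare_Skip])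
    fix v m :: "nat \<Rightarrow> nat"
    assume *: "(?P v m \<and> eval v m (Var 6) \<le> eval v m (Mem (label_at 1))) \<and>
      eval v m (Mem (label_at 1)) \<le> eval v m (Var 6)" and b: "bounded X v m"
    have "v 1 = n" using * by (simp add: good_def)
    then have "v 6 = tgt" using * t[of v m] by simp
    moreover have "v 2 \<le> X" using b by (simp add: bounded_def)
    ultimately show "eval v m (Var 2) \<le> X \<and> ?Q (v(7 := eval v m (Var 2), 8 := 1)) m"
      using * eq[of v m] by simp
  next
    fix v m :: "nat \<Rightarrow> nat"
    assume "?Q (v(8 := 1)) m" "bounded X v m"
    then show "eval v m (Const 1) \<le> X \<and> ?Q (v(8 := eval v m (Const 1))) m" using X by simp
  next
    fix v m :: "nat \<Rightarrow> nat"
    assume *: "(?P v m \<and> eval v m (Var 6) \<le> eval v m (Mem (label_at 1))) \<and>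
      \<not> eval v m (Mem (label_at 1)) \<le> eval v m (Var 6)"
    have "v 1 = n" using * by (simp add: good_def)
    then show "?Q v m" using * t[of v m] by (intro neq) auto
  next
    fix v m :: "nat \<Rightarrow> nat"
    assume *: "?P v m \<and> \<not> eval v m (Var 6) \<le> eval v m (Mem (label_at 1))"
    have "v 1 = n" using * by (simp add: good_def)
    then show "?Q v m" using * t[of v m] by (intro neq) auto
  qed auto
qed

abbreviation child :: exp where
  "child \<equiv> Plus (Const 1) (Plus (Times (Var 2) (Var 1)) (Var 3))"

text \<open>The sum of two 0/1 entries expresses the union, and \<open>cell 4 3\<close> walks down a
  column of the matrix, which is the ideal of one vertex. Writing zeros too makes the step
  independent of what the row contained before.\<close>

definition extend_com :: com where
  "extend_com = For 3 1 (For 4 1 (Cond (Const 1) (Plus (Mem (item_at g (Var 2) 4)) (Mem (cell 4 3)))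
     (Write (item_at g child 4) (Const 1)) (Write (item_at g child 4) (Const 0))))"

lemma item_addr_eq:
  "w < n \<Longrightarrow> w' < n \<Longrightarrow> item_addr n g i w = item_addr n g i' w' \<longleftrightarrow> i = i' \<and> w = w'"
  by (simp add: item_addr_def row_col_inj)

lemma extend_com:
  "hoare X (\<lambda>v m. good K k (i * n) v m \<and> v 2 = i) extend_com
     (\<lambda>v m. good K k (Suc i * n) v m \<and> v 2 = i)"
  unfolding extend_com_def
proof (rule hoare_For[where N = n and I = "\<lambda>u v m. good K k (i * n + u) v m \<and> v 2 = i"])
  fix u assume u: "u < n"
  let ?c = "Suc (i * n + u)"
  let ?I = "\<lambda>j v m. good K k (i * n + u) v m \<and> v 2 = i \<and> v 3 = u \<and>
     (\<forall>w<j. m (item_addr n g ?c w) = of_bool (w \<in> S ?c))"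
  have iu: "i \<le> i * n + u" using u by (cases n) auto
  show "hoare X (\<lambda>v m. (good K k (i * n + u) v m \<and> v 2 = i) \<and> v 3 = u \<and> v 1 = n)
    (For 4 1 (Cond (Const 1) (Plus (Mem (item_at g (Var 2) 4)) (Mem (cell 4 3)))
     (Write (item_at g child 4) (Const 1)) (Write (item_at g child 4) (Const 0))))
    (\<lambda>v m. (good K k (i * n + Suc u) v m \<and> v 2 = i) \<and> v 3 = u \<and> v 1 = n)"
  proof (rule hoare_For[where N = n and I = ?I])
    fix j assume j: "j < n"
    let ?P = "\<lambda>(v :: nat \<Rightarrow> nat) m. ?I j v m \<and> v 4 = j \<and> v 1 = n"
    have step: "?I (Suc j) v (m(item_addr n g ?c j := of_bool (j \<in> S ?c)))" if "?I j v m" for v m :: "nat \<Rightarrow> nat"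
    proof -
      have "items (m(item_addr n g ?c j := b)) (i * n + u)" if "items m (i * n + u)" for b
        using that j by (auto simp: items_def item_addr_eq)
      then show ?thesis using that j
        by (auto simp: good_def input_write item_addr_eq less_Suc_eq)
    qed
    have read: "1 \<le> m (item_addr n g i j) + m (Suc (j * n + u)) \<longleftrightarrow> j \<in> S ?c" if "?I j v m" for v m :: "nat \<Rightarrow> nat"
    proof -
      have "m (item_addr n g i j) = of_bool (j \<in> S i)" "m (Suc (j * n + u)) = of_bool (j \<in> D u)"
        using that iu j u by (auto simp: good_def items_def input_def D_def)
      then show ?thesis unfolding item_child[OF u] by auto
    qed
    show "hoare X ?P (Cond (Const 1) (Plus (Mem (item_at g (Var 2) 4)) (Mem (cell 4 3)))
       (Write (item_at g child 4) (Const 1)) (Write (item_at g child 4) (Const 0)))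
       (\<lambda>v m. ?I (Suc j) v m \<and> v 4 = j \<and> v 1 = n)"
    proof (rule hoare_Cond[OF _ _ hoare_Write hoare_Write])
      fix v m :: "nat \<Rightarrow> nat"
      assume *: "?P v m \<and> eval v m (Const 1) \<le> eval v m (Plus (Mem (item_at g (Var 2) 4)) (Mem (cell 4 3)))"
      then have "1 \<le> m (item_addr n g i j) + m (Suc (j * n + u))" by auto
      with read[OF conjunct1[OF conjunct1[OF *]]] have "j \<in> S ?c" by simp
      then show "eval v m (Const 1) \<le> X \<and>
          ?I (Suc j) v (m(eval v m (item_at g child 4) := eval v m (Const 1))) \<and> v 4 = j \<and> v 1 = n"
        using * X step[OF conjunct1[OF conjunct1[OF *]]] \<open>j \<in> S ?c\<close> by simp
    next
      fix v m :: "nat \<Rightarrow> nat"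
      assume *: "?P v m \<and> \<not> eval v m (Const 1) \<le> eval v m (Plus (Mem (item_at g (Var 2) 4)) (Mem (cell 4 3)))"
      then have "\<not> 1 \<le> m (item_addr n g i j) + m (Suc (j * n + u))" by auto
      with read[OF conjunct1[OF conjunct1[OF *]]] have "j \<notin> S ?c" by simp
      then show "eval v m (Const 0) \<le> X \<and>
          ?I (Suc j) v (m(eval v m (item_at g child 4) := eval v m (Const 0))) \<and> v 4 = j \<and> v 1 = n"
        using * X step[OF conjunct1[OF conjunct1[OF *]]] \<open>j \<notin> S ?c\<close> by simp
    qed auto
  next
    fix v m :: "nat \<Rightarrow> nat"
    assume "?I n v m" "v 1 = n"
    then show "(good K k (i * n + Suc u) v m \<and> v 2 = i) \<and> v 3 = u \<and> v 1 = n"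
      by (auto simp: good_def items_def le_Suc_eq)
  qed (simp_all, ((elim conjE)?, erule good_vars)?)
qed (simp_all add: add.commute, ((elim conjE)?, erule good_vars)?)

definition search_com :: com where
  "search_com = For 2 5 (Then product_com (Then check_com extend_com))"

lemma search_com:
  "hoare X (good K 0 0) search_com (good K K (K * n))"
  unfolding search_com_def
proof (rule hoare_For[where N = K and I = "\<lambda>i. good K i (i * n)"])
  fix i
  show "hoare X (\<lambda>v m. good K i (i * n) v m \<and> v 2 = i \<and> v 5 = K) (Then product_com (Then check_com extend_com))
    (\<lambda>v m. good K (Suc i) (Suc i * n) v m \<and> v 2 = i \<and> v 5 = K)"
    by (rule hoare_conseq[OF hoare_Then[OF product_com hoare_Then[OF check_com extend_com]]])
      (auto simp: good_def)
qed (simp_all, ((elim conjE)?, erule good_vars)?)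

text \<open>The output overwrites the beginning of the input. By then \<open>n\<close> is kept in
  variable 1, and the item rows lie behind the cells that are overwritten.\<close>

definition output_com :: com where
  "output_com = Cond (Const 1) (Var 8)
     (Then (Write (Const 0) (Const 1))
       (Then (For 2 1 (Write (Plus (Const 1) (Var 2)) (Mem (item_at g (Var 7) 2))))
         (Assign 0 (Plus (Var 1) (Const 1)))))
     (Then (Write (Const 0) (Const 0)) (Assign 0 (Const 1)))"

lemma output_com:
  "hoare X (\<lambda>v m. good K K (K * n) v m) output_com
     (\<lambda>v m. v 0 = 1 \<and> m 0 = 0 \<and> (\<forall>i<K. partial f a l (S i) n \<noteq> tgt) \<or>
       (\<exists>i<K. partial f a l (S i) n = tgt \<and> v 0 = n + 1 \<and> m 0 = 1 \<and>
          (\<forall>w<n. m (Suc w) = of_bool (w \<in> S i))))"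
  (is "hoare X _ _ ?Q")
proof -
  let ?J = "\<lambda>m i. i < K \<and> partial f a l (S i) n = tgt \<and> (\<forall>w<n. m (item_addr n g i w) = of_bool (w \<in> S i))"
  let ?P1 = "\<lambda>(v :: nat \<Rightarrow> nat) m. v 1 = n \<and> ?J m (v 7)"
  let ?P2 = "\<lambda>(v :: nat \<Rightarrow> nat) m. ?P1 v m \<and> m 0 = 1"
  let ?I = "\<lambda>j v m. ?P2 v m \<and> (\<forall>w<j. m (Suc w) = of_bool (w \<in> S (v 7)))"
  have addr: "item_addr n g i w \<noteq> 0" "w' < n \<Longrightarrow> item_addr n g i w \<noteq> Suc w'" for i w w'
    by (auto simp: item_addr_def table_addr_def)
  have loop: "hoare X ?P2 (For 2 1 (Write (Plus (Const 1) (Var 2)) (Mem (item_at g (Var 7) 2)))) (?I n)"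
  proof (rule hoare_For[where N = n and I = ?I])
    fix j assume j: "j < n"
    show "hoare X (\<lambda>v m. ?I j v m \<and> v 2 = j \<and> v 1 = n) (Write (Plus (Const 1) (Var 2)) (Mem (item_at g (Var 7) 2)))
      (\<lambda>v m. ?I (Suc j) v m \<and> v 2 = j \<and> v 1 = n)"
      by (rule hoare_Write) (use j addr in \<open>auto simp: less_Suc_eq bounded_def\<close>)
  qed auto
  show ?thesis
    unfolding output_com_def
  proof (rule hoare_Cond)
    show "hoare X (\<lambda>v m. good K K (K * n) v m \<and> eval v m (Const 1) \<le> eval v m (Var 8))
       (Then (Write (Const 0) (Const 1))
       (Then (For 2 1 (Write (Plus (Const 1) (Var 2)) (Mem (item_at g (Var 7) 2))))
         (Assign 0 (Plus (Var 1) (Const 1))))) ?Q"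
    proof (rule hoare_Then[OF hoare_Write hoare_Then[OF loop hoare_Assign]])
      fix v m :: "nat \<Rightarrow> nat"
      assume *: "good K K (K * n) v m \<and> eval v m (Const 1) \<le> eval v m (Var 8)"
      then have 1: "v 1 = n" "v 7 < K" "partial f a l (S (v 7)) n = tgt" "items m (K * n)"
        unfolding good_def found_def by auto
      \<comment> \<open>For \<open>n = 0\<close> a row has no entries; otherwise
        \<open>K \<le> K * n\<close>, so the row of the solution has been written.\<close>
      have "v 7 \<le> K * n" if "w < n" for w using 1(2) that by (cases n) auto
      with 1 have "?P1 v m" unfolding items_def by blast
      then show "eval v m (Const 1) \<le> X \<and> ?P2 v (m(eval v m (Const 0) := eval v m (Const 1)))"
        using X by (auto simp: addr)
    qed (use X in auto)
  next
    show "hoare X (\<lambda>v m. good K K (K * n) v m \<and> \<not> eval v m (Const 1) \<le> eval v m (Var 8))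
       (Then (Write (Const 0) (Const 0)) (Assign 0 (Const 1))) ?Q"
    proof (rule hoare_Then[OF hoare_Write hoare_Assign])
      fix v m :: "nat \<Rightarrow> nat"
      assume *: "good K K (K * n) v m \<and> \<not> eval v m (Const 1) \<le> eval v m (Var 8)"
      then show "eval v m (Const 0) \<le> X \<and> (m(eval v m (Const 0) := eval v m (Const 0))) 0 = 0 \<and>
         (\<forall>i<K. partial f a l (S i) n \<noteq> tgt)" by (auto simp: good_def found_def)
    qed (use X in auto)
  qed auto
qed

end

section \<open>Group-constrained lattice feasibility\<close>

text \<open>Outside the locale, \<open>search_com\<close> and \<open>output_com\<close> take only
  \<open>g\<close> and \<open>a\<close> as parameters. So neither \<open>n\<close> nor
  \<open>X\<close> nor other data of the instance occur in the program, and one program serves all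
  instances.\<close>

definition main_com :: "nat \<Rightarrow> nat \<Rightarrow> (nat \<Rightarrow> nat \<Rightarrow> nat) \<Rightarrow> com" where
  "main_com g a f = Then (Assign 1 (Mem (Const 0))) (Then diag_com (Then warshall_com
     (Then (table_com (\<lambda>i. f (i div g) (i mod g)) (g * g)) (Then (power_com g) (Then (Assign 8 (Const 0))
       (Then (enumeration.search_com g a) (enumeration.output_com g)))))))"

lemma (in enumeration) main_com:
  assumes E: "E \<subseteq> {..<n} \<times> {..<n}" and R: "R = E\<^sup>*"
    and gX: "g \<le> X" and K: "(n + 1) ^ g \<le> X"
    and m0: "m0 0 = n" "\<And>u w. u < n \<Longrightarrow> w < n \<Longrightarrow> m0 (Suc (u * n + w)) = of_bool ((u, w) \<in> E)"
      "\<And>w. w < n \<Longrightarrow> m0 (Suc (n * n + w)) = l w" "m0 (Suc (n * n + n)) = tgt"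
      "\<And>i. table_addr n \<le> i \<Longrightarrow> m0 i = 0"
  shows "hoare X (\<lambda>v m. m = m0) (main_com g a f)
     (\<lambda>v m. v 0 = 1 \<and> m 0 = 0 \<and> (\<forall>i<(n + 1) ^ g. partial f a l (S i) n \<noteq> tgt) \<or>
       (\<exists>i<(n + 1) ^ g. partial f a l (S i) n = tgt \<and> v 0 = n + 1 \<and> m 0 = 1 \<and>
          (\<forall>w<n. m (Suc w) = of_bool (w \<in> S i))))"
proof -
  have X1: "1 \<le> X" using X by simp
  let ?W = "warshall (E \<union> Id_on {..<n}) n"
  let ?P = "\<lambda>m. input m \<and> items m 0"
  have init: "hoare X (\<lambda>v m. m = m0) (Assign 1 (Mem (Const 0))) (\<lambda>v m. v 1 = n \<and> mat n m0 m E)"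
    by (rule hoare_Assign) (use X m0 in \<open>auto simp: mat_def\<close>)
  have tab: "hoare X (\<lambda>v m. v 1 = n \<and> mat n m0 m ?W) (table_com (\<lambda>i. f (i div g) (i mod g)) (g * g))
    (\<lambda>v m. v 1 = n \<and> ?P m)"
  proof (rule hoare_ghost)
    fix v1 m1 :: "nat \<Rightarrow> nat" assume 1: "v1 1 = n \<and> mat n m0 m1 ?W"
    have fX: "f (i div g) (i mod g) \<le> X" if "i < g * g" for i
    proof -
      have "0 < g" using a by simp
      then have "f (i div g) (i mod g) < g" using that by (intro f) (auto simp: less_mult_imp_div_less)
      then show ?thesis using gX by simp
    qed
    show "hoare X (\<lambda>v m. v = v1 \<and> m = m1) (table_com (\<lambda>i. f (i div g) (i mod g)) (g * g))
      (\<lambda>v m. v 1 = n \<and> ?P m)"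
    proof (rule hoare_conseq[OF table_com[of "g * g" "\<lambda>i. f (i div g) (i mod g)" X n m1, OF fX]])
      fix v m :: "nat \<Rightarrow> nat"
      assume *: "v 1 = n \<and> (\<forall>i<g * g. m (table_addr n + i) = f (i div g) (i mod g)) \<and>
        (\<forall>b. b < table_addr n \<or> table_addr n + g * g \<le> b \<longrightarrow> m b = m1 b)"
      have xy: "x * g + y < g * g" if "x < g" "y < g" for x y
        using row_col_le[OF that] by simp
      have "m (Suc (u * n + w)) = of_bool ((u, w) \<in> R)" if "u < n" "w < n" for u w
      proof -
        have "Suc (u * n + w) < table_addr n" using row_col_le[OF that] by (simp add: table_addr_def)
        then have "m (Suc (u * n + w)) = of_bool ((u, w) \<in> ?W)" using * 1 that by (simp add: mat_def)
        then show ?thesis using warshall_rtrancl[OF E that] by (simp add: R)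
      qed
      \<comment> \<open>The case \<open>w = n\<close> is the target.\<close>
      moreover have "m (Suc (n * n + w)) = m0 (Suc (n * n + w))" if "w \<le> n" for w
        using * 1 that by (simp add: mat_def table_addr_def)
      moreover have "m (table_addr n + (x * g + y)) = f x y" if "x < g" "y < g" for x y
        using * xy[OF that] that by simp
      ultimately have "input m" using m0 by (simp add: input_def)
      \<comment> \<open>The root of the tree, the empty set, is never written; the zeros of the
        initial memory represent it.\<close>
      moreover have "m (item_addr n g 0 w) = 0" for w
        using * 1 m0(5) by (simp add: item_addr_def mat_def table_addr_def)
      ultimately show "v 1 = n \<and> ?P m" using * by (simp add: items_def)
    qed (use 1 in auto)
  qed
  have flag: "hoare X (\<lambda>v m. v 1 = n \<and> v 5 = (n + 1) ^ g \<and> ?P m) (Assign 8 (Const 0)) (good ((n + 1) ^ g) 0 0)"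
    by (rule hoare_Assign) (auto simp: good_def found_def)
  show ?thesis unfolding main_com_def
    by (rule hoare_Then[OF init hoare_Then[OF diag_com[OF X1] hoare_Then[OF warshall_com[OF X1]
      hoare_Then[OF tab hoare_Then[OF power_com[OF K] hoare_Then[OF flag
      hoare_Then[OF search_com output_com]]]]]]])
qed

section \<open>Encoding lengths and the ground set as list positions\<close>

lemma nth_concat_map:
  "i < length us \<Longrightarrow> j < length vs \<Longrightarrow>
   concat (map (\<lambda>u. map (F u) vs) us) ! (i * length vs + j) = F (us ! i) (vs ! j)"
proof (induction us arbitrary: i)
  case (Cons u us)
  show ?case
  proof (cases i)
    case (Suc i')
    then show ?thesis using Cons by (simp add: nth_append add.assoc)
  qed (use Cons in \<open>simp add: nth_append\<close>)
qed simp

lemma poly_nat_mono: "x \<le> y \<Longrightarrow> poly p x \<le> poly p y" for p :: "nat poly"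
  by (induction p) (auto intro!: add_mono mult_mono)

text \<open>Every number has at least its sign bit. This turns a size bound in the number of inputs
  into one in their total encoding length.\<close>

lemma length_le_sum_rat_bits: "length xs \<le> (\<Sum>x\<leftarrow>xs. rat_bits x)"
proof (induction xs)
  case (Cons x xs)
  have "1 \<le> rat_bits x" by (simp add: rat_bits_def split: prod.split)
  then show ?case using Cons by simp
qed simp

definition index_arcs :: "'v list \<Rightarrow> ('v \<times> 'v) set \<Rightarrow> nat rel" where
  "index_arcs vs A = {(u, w). u < length vs \<and> w < length vs \<and> (vs ! u, vs ! w) \<in> A}"

lemma acyclic_index_arcs: "acyclic A \<Longrightarrow> acyclic (index_arcs vs A)"
proof -
  have "(vs ! u, vs ! w) \<in> A\<^sup>+" if "(u, w) \<in> (index_arcs vs A)\<^sup>+" for u w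
    using that by induction (auto simp: index_arcs_def intro: trancl_into_trancl)
  then show "acyclic A \<Longrightarrow> acyclic (index_arcs vs A)" unfolding acyclic_def by blast
qed

lemma lattice_of_index_image:
  assumes "A \<subseteq> set vs \<times> set vs" "T \<in> lattice_of {..<length vs} (index_arcs vs A)"
  shows "(!) vs ` T \<in> lattice_of (set vs) A"
  unfolding lattice_of_def
proof (intro CollectI conjI notI)
  show "(!) vs ` T \<subseteq> set vs" using assms(2) by (auto simp: lattice_of_def)
  assume "\<exists>a\<in>A. enters a ((!) vs ` T)"
  then obtain x w where x: "(x, vs ! w) \<in> A" "x \<notin> (!) vs ` T" "w \<in> T" by (auto simp: enters_def)
  then obtain u where u: "u < length vs" "x = vs ! u" using assms(1) by (metis in_set_conv_nth mem_Sigma_iff subsetD)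
  have "w < length vs" using assms(2) x by (auto simp: lattice_of_def)
  then have "(u, w) \<in> index_arcs vs A" "u \<notin> T" using x u by (auto simp: index_arcs_def)
  then show False using assms(2) x(3) by (force simp: lattice_of_def enters_def)
qed

lemma lattice_of_index_preimage:
  assumes "Y \<in> lattice_of (set vs) A"
  shows "{w. w < length vs \<and> vs ! w \<in> Y} \<in> lattice_of {..<length vs} (index_arcs vs A)"
  using assms by (fastforce simp: lattice_of_def enters_def index_arcs_def)

section \<open>Group elements as numbers, and the final program\<close>

context
  fixes G :: "('g, 'm) monoid_scheme" and e :: "'g \<Rightarrow> nat"
  assumes G: "comm_group G" and fin: "finite (carrier G)"
    and e: "bij_betw e (carrier G) {..<card (carrier G)}"
begin

interpretation comm_group G by (rule G)

definition code_mult :: "nat \<Rightarrow> nat \<Rightarrow> nat" where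
  "code_mult x y = e (inv_into (carrier G) e x \<otimes>\<^bsub>G\<^esub> inv_into (carrier G) e y)"

lemma e_less: "x \<in> carrier G \<Longrightarrow> e x < card (carrier G)"
  using e by (auto simp: bij_betw_def)

lemma e_inject: "x \<in> carrier G \<Longrightarrow> y \<in> carrier G \<Longrightarrow> e x = e y \<longleftrightarrow> x = y"
  using e by (auto simp: bij_betw_def inj_on_eq_iff)

lemma code_mult: "x \<in> carrier G \<Longrightarrow> y \<in> carrier G \<Longrightarrow> code_mult (e x) (e y) = e (x \<otimes>\<^bsub>G\<^esub> y)"
  using e by (simp add: code_mult_def bij_betw_def)

lemma code_mult_less: "x < card (carrier G) \<Longrightarrow> y < card (carrier G) \<Longrightarrow> code_mult x y < card (carrier G)"
  unfolding code_mult_def using e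
  by (intro e_less m_closed inv_into_into) (auto simp: bij_betw_def)

text \<open>The link between the computed code and the group. The program multiplies new factors
  from the right and \<open>finprod_insert\<close> from the left, so commutativity is used.\<close>

lemma partial_finprod:
  assumes "\<And>w. w < n \<Longrightarrow> h w \<in> carrier G" "\<And>w. w < n \<Longrightarrow> l w = e (h w)" "j \<le> n"
  shows "partial code_mult (e \<one>\<^bsub>G\<^esub>) l T j = e (finprod G h (T \<inter> {..<j}))"
  using assms(3)
proof (induction j)
  case (Suc j)
  have h: "h \<in> A \<rightarrow> carrier G" if "A \<subseteq> {..<n}" for A using assms(1) that by auto
  have "T \<inter> {..<j} \<subseteq> {..<n}" using Suc.prems by auto
  note hT = h[OF this]
  have c: "finprod G h (T \<inter> {..<j}) \<in> carrier G" by (rule finprod_closed[OF hT])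
  have "finprod G h (T \<inter> {..<Suc j}) = (if j \<in> T then h j \<otimes>\<^bsub>G\<^esub> finprod G h (T \<inter> {..<j}) else finprod G h (T \<inter> {..<j}))"
    using hT Suc.prems assms(1)[of j] finprod_insert[of "T \<inter> {..<j}" j h] by (auto simp: lessThan_Suc Int_insert_right)
  then show ?case using Suc c assms(1,2)[of j] by (simp add: code_mult m_comm)
qed simp

definition solver :: com where
  "solver = main_com (card (carrier G)) (e \<one>\<^bsub>G\<^esub>) code_mult"

definition input_codes :: "'v list \<times> ('v, 'g) gclf \<Rightarrow> nat list" where
  "input_codes = (\<lambda>(vs, P). [length vs] @
     concat (map (\<lambda>u. map (\<lambda>v. of_bool ((u, v) \<in> arcs P)) vs) vs) @ map (\<lambda>v. e (label P v)) vs @ [e (target P)])"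

lemma gclf_encoding_codes: "gclf_encoding e x = map of_nat (input_codes x)"
  by (auto simp: gclf_encoding_def input_codes_def map_concat comp_def of_bool_def split: prod.split
      intro!: arg_cong[of _ _ concat] map_cong)

lemma length_input_codes: "length (input_codes (vs, P)) = length vs * length vs + length vs + 2"
  by (simp add: input_codes_def length_concat comp_def sum_list_triv)

text \<open>The summands of \<open>X\<close> cover what is stored: the power is the number of tree
  nodes, \<open>n * n + n\<close> together with part of the 5 covers the input length in register 0,
  and the order of the group covers the codes of its elements.\<close>

lemma solver_correct:
  fixes vs :: "'v list" and P :: "('v, 'g) gclf"
  assumes P: "gclf_problem G P" and vs: "distinct vs" "set vs = ground P"
    and n: "n = length vs" and X_eq: "X = (n + 1) ^ card (carrier G) + n * n + n + card (carrier G) + 5"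
  shows "\<exists>t b s ys. exec (compile solver) (init_state (gclf_encoding e (vs, P))) t b s \<and>
    t \<le> poly (ctime solver) X \<and> b \<le> X ^ cdeg solver + 3 \<and> holds_output s ys \<and> gclf_correct_output G (vs, P) ys"
proof -
  define g where "g = card (carrier G)"
  define E where "E = index_arcs vs (arcs P)"
  define h where "h w = label P (vs ! w)" for w
  define l where "l w = e (h w)" for w
  define ns where "ns = input_codes (vs, P)"
  define m0 where "m0 i = (if i < length ns then ns ! i else 0)" for i
  define v0 :: "nat \<Rightarrow> nat" where "v0 i = (if i = 0 then length ns else 0)" for i
  define tgt where "tgt = e (target P)"
  have P': "finite (ground P)" "arcs P \<subseteq> set vs \<times> set vs" "acyclic (arcs P)"
    "label P \<in> set vs \<rightarrow> carrier G" "target P \<in> carrier G"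
    using P vs by (auto simp: gclf_problem_def)
  have h: "h w \<in> carrier G" if "w < n" for w using that P'(4) by (auto simp: h_def n)
  have one: "e \<one>\<^bsub>G\<^esub> < g" unfolding g_def by (rule e_less) simp
  have "e \<one>\<^bsub>G\<^esub> \<le> X" using one unfolding X_eq g_def[symmetric] by linarith
  moreover have "2 \<le> X" "n + 1 \<le> X" by (simp_all add: X_eq)
  ultimately interpret enumeration X n g "e \<one>\<^bsub>G\<^esub>" tgt code_mult l "E\<^sup>*"
    by unfold_locales (use one h in \<open>auto simp: g_def l_def code_mult_less e_less\<close>)
  have E: "E \<subseteq> {..<n} \<times> {..<n}" by (auto simp: E_def index_arcs_def n)
  have len: "length ns = table_addr n" by (simp add: ns_def length_input_codes table_addr_def n)
  have m0: "m0 0 = n" "\<And>u w. u < n \<Longrightarrow> w < n \<Longrightarrow> m0 (Suc (u * n + w)) = of_bool ((u, w) \<in> E)"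
      "\<And>w. w < n \<Longrightarrow> m0 (Suc (n * n + w)) = l w" "m0 (Suc (n * n + n)) = tgt"
      "\<And>i. table_addr n \<le> i \<Longrightarrow> m0 i = 0"
  proof -
    define c where "c = concat (map (\<lambda>u. map (\<lambda>v. of_bool ((u, v) \<in> arcs P)) vs) vs :: nat list list)"
    have lc: "length c = n * n" by (simp add: c_def length_concat comp_def sum_list_triv n)
    have ns: "ns = n # c @ map (\<lambda>v. e (label P v)) vs @ [tgt]"
      by (simp add: ns_def input_codes_def c_def n tgt_def)
    show "m0 0 = n" by (simp add: m0_def ns)
    show "m0 (Suc (u * n + w)) = of_bool ((u, w) \<in> E)" if "u < n" "w < n" for u w
    proof -
      have "u * n + w < n * n" using row_col_le[OF that] by simp
      moreover have "c ! (u * n + w) = of_bool ((u, w) \<in> E)"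
        using nth_concat_map[of u vs w vs "\<lambda>u v. of_bool ((u, v) \<in> arcs P)"] that
        by (simp add: c_def n E_def index_arcs_def)
      ultimately show ?thesis by (simp add: m0_def ns nth_append lc)
    qed
    show "m0 (Suc (n * n + w)) = l w" if "w < n" for w
      using that by (simp add: m0_def ns nth_append lc l_def h_def n)
    show "m0 (Suc (n * n + n)) = tgt" by (simp add: m0_def ns nth_append lc n)
    show "m0 i = 0" if "table_addr n \<le> i" for i using that by (simp add: m0_def len)
  qed
  have m0X: "m0 i \<le> X" for i
  proof -
    have "k \<le> X" if "k \<in> set ns" for k
    proof -
      have "e x \<le> X" if "x \<in> carrier G" for x using e_less[OF that] by (simp add: X_eq)
      then show ?thesis using that P'(4,5)
        by (auto simp: ns_def input_codes_def X_eq n Pi_iff)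
    qed
    then show ?thesis by (simp add: m0_def)
  qed
  have v0X: "v0 i \<le> X" for i by (simp add: v0_def len table_addr_def X_eq)
  have bnd: "bounded X v0 m0" using m0X v0X X(1) by (simp add: bounded_def)
  define R0 :: "nat \<Rightarrow> rat" where "R0 i = (if i = 0 then of_nat (length ns) else 0)" for i
  have "agree v0 R0" by (simp add: agree_def v0_def R0_def)
  have start: "init_state (gclf_encoding e (vs, P)) = (R0, lift m0)"
    by (auto simp: init_state_def gclf_encoding_codes ns_def[symmetric] lift_def m0_def R0_def fun_eq_iff)
  have "g \<le> X" "(n + 1) ^ g \<le> X" by (simp_all add: X_eq g_def)
  note mc = main_com[OF E refl this, of m0]
  let ?Q = "\<lambda>v m. v 0 = 1 \<and> m 0 = 0 \<and> (\<forall>i<(n + 1) ^ g. partial code_mult (e \<one>\<^bsub>G\<^esub>) l (S i) n \<noteq> tgt) \<or>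
       (\<exists>i<(n + 1) ^ g. partial code_mult (e \<one>\<^bsub>G\<^esub>) l (S i) n = tgt \<and> v 0 = n + 1 \<and> m 0 = 1 \<and>
          (\<forall>w<n. m (Suc w) = of_bool (w \<in> S i)))"
  have "hoare X (\<lambda>v m. m = m0) solver ?Q"
    unfolding solver_def g_def[symmetric] by (rule mc) (use m0 in simp_all)
  from hoareD[OF this, OF bnd \<open>agree v0 R0\<close> refl]
  obtain v m R where run: "computes (compile solver) (R0, lift m0) (poly (ctime solver) X) (X ^ cdeg solver + 3) (R, lift m)"
    and ag: "agree v R" and out: "?Q v m"
    by (rule outcomeE)
  have R0: "R 0 = of_nat (v 0)" using ag by (simp add: agree_def)
  have DD: "D = down n E" by (simp add: fun_eq_iff D_def down_def)
  have S: "S i \<in> lattice_of {..<n} E" for i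
    unfolding DD using item_in_lattice down_in_lattice[OF E] .
  have hits: "partial code_mult (e \<one>\<^bsub>G\<^esub>) l T n = tgt \<longleftrightarrow> finprod G h T = target P" if "T \<subseteq> {..<n}" for T
  proof -
    have "T \<inter> {..<n} = T" using that by auto
    then have "partial code_mult (e \<one>\<^bsub>G\<^esub>) l T n = e (finprod G h T)"
      using partial_finprod[of n h l n T] h by (simp add: l_def)
    moreover have "finprod G h T \<in> carrier G" using that h by (intro finprod_closed) auto
    ultimately show ?thesis using e_inject P'(5) by (simp add: tgt_def)
  qed
  have reindex: "finprod G (label P) ((!) vs ` T) = finprod G h T" if "T \<subseteq> {..<n}" for T
  proof -
    have "inj_on ((!) vs) T" using vs(1) that by (intro inj_on_nth) (auto simp: n)
    moreover have "label P \<in> (!) vs ` T \<rightarrow> carrier G"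
      using that h by (auto simp: h_def)
    ultimately show ?thesis using finprod_reindex[of "label P" "(!) vs" T] by (simp add: h_def[abs_def])
  qed
  have "\<exists>ys. holds_output (R, lift m) ys \<and> gclf_correct_output G (vs, P) ys"
    using out
  proof (elim disjE exE conjE)
    assume none: "v 0 = 1" "m 0 = 0" "\<forall>i<(n + 1) ^ g. partial code_mult (e \<one>\<^bsub>G\<^esub>) l (S i) n \<noteq> tgt"
    have "\<not> gclf_solution G P Y" for Y
    proof
      assume Y: "gclf_solution G P Y"
      define T where "T = {w. w < n \<and> vs ! w \<in> Y}"
      have T: "T \<in> lattice_of {..<n} E"
        using lattice_of_index_preimage[of Y vs "arcs P"] Y vs by (simp add: gclf_solution_def T_def E_def n)
      have Ts: "T \<subseteq> {..<n}" by (auto simp: T_def)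
      have "Y \<subseteq> set vs" using Y vs by (simp add: gclf_solution_def lattice_of_def)
      then have "(!) vs ` T = Y" by (force simp: T_def n in_set_conv_nth)
      then have "finprod G h T = target P" using reindex[OF Ts] Y by (simp add: gclf_solution_def)
      \<comment> \<open>The set \<open>T\<close> itself need not be among the tested items. But a
        set \<open>U\<close> of the same value with fewer than \<open>g\<close> generators is, and
        its index is small enough.\<close>
      moreover obtain F U where FU: "finprod G h U = finprod G h T" "F \<subseteq> {..<n}" "card F < g"
          "U = {u. \<exists>v\<in>F. (u, v) \<in> E\<^sup>*}" "U \<in> lattice_of {..<n} E"
        using few_generators[OF G fin _ E _ _ T, of h] h acyclic_index_arcs[OF P'(3), of vs]
        unfolding g_def E_def by auto
      moreover have "U = (\<Union>v\<in>F. D v)"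
        using FU(4,5) by (auto simp: D_def lattice_of_def)
      moreover have "finite F" using FU(2) by (rule finite_subset) simp
      ultimately obtain i where i: "i < (n + 1) ^ card F" "S i = U"
        using item_surj[of F n D] by auto
      have "i < (n + 1) ^ g" using i(1) power_increasing[of "card F" g "n + 1"] FU(3) by simp
      moreover have "partial code_mult (e \<one>\<^bsub>G\<^esub>) l (S i) n = tgt"
        using hits[of U] FU(1,5) \<open>finprod G h T = target P\<close> i(2) by (simp add: lattice_of_def)
      ultimately show False using none(3) by blast
    qed
    then have "gclf_correct_output G (vs, P) [0]" by (simp add: gclf_correct_output_def)
    moreover have "holds_output (R, lift m) [0]" using none R0 by (simp add: holds_output_def lift_def)
    ultimately show ?thesis by blast
  next
    fix i
    assume i: "partial code_mult (e \<one>\<^bsub>G\<^esub>) l (S i) n = tgt" "v 0 = n + 1" "m 0 = 1"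
      "\<forall>w<n. m (Suc w) = of_bool (w \<in> S i)"
    have Si: "S i \<subseteq> {..<n}" using S[of i] by (simp add: lattice_of_def)
    let ?Y = "(!) vs ` S i"
    have sol: "gclf_solution G P ?Y"
      using lattice_of_index_image[OF P'(2), of "S i"] S[of i] hits[OF Si] i(1) reindex[OF Si] vs(2)
      by (simp add: gclf_solution_def E_def n)
    have mem: "vs ! w \<in> ?Y \<longleftrightarrow> w \<in> S i" if "w < n" for w
      using that vs(1) Si by (auto simp: n nth_eq_iff_index_eq subset_iff)
    let ?ys = "1 # map (\<lambda>v. if v \<in> ?Y then 1 else 0) vs :: rat list"
    have "lift m a = ?ys ! a" if "a < length ?ys" for a
      using that i(3,4) mem by (cases a) (auto simp: lift_def n simp del: image_iff)
    then have "holds_output (R, lift m) ?ys" using R0 i(2) by (simp add: holds_output_def n)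
    moreover have "gclf_correct_output G (vs, P) ?ys" using sol by (auto simp: gclf_correct_output_def)
    ultimately show ?thesis by blast
  qed
  with run show ?thesis unfolding start computes_def by blast
qed

lemma gclf_solvable:
  "solvable_in_strongly_polynomial_time
    (gclf_instances G :: ('v list \<times> ('v, 'g) gclf) set) (gclf_encoding e) (gclf_correct_output G)"
proof -
  define Xp :: "nat poly" where
    "Xp = [:1, 1:] ^ card (carrier G) + [:0, 1:] * [:0, 1:] + [:0, 1:] + [:card (carrier G) + 5:]"
  have Xp: "poly Xp n = (n + 1) ^ card (carrier G) + n * n + n + card (carrier G) + 5" for n
    by (simp add: Xp_def poly_power)
  \<comment> \<open>\<open>X\<close> depends on \<open>n\<close> alone, not on the size of the input
    numbers. As \<open>n\<close> is at most the number of inputs, and this is at most their total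
    encoding length, monotonicity of polynomials over the naturals gives both bounds.\<close>
  define p where "p = pcompose (ctime solver) Xp"
  define q where "q = Xp ^ cdeg solver + [:3:]"
  have "\<exists>t b s ys. exec (compile solver) (init_state (gclf_encoding e x)) t b s \<and>
      t \<le> poly p (length (gclf_encoding e x)) \<and> b \<le> poly q (\<Sum>z\<leftarrow>gclf_encoding e x. rat_bits z) \<and>
      holds_output s ys \<and> gclf_correct_output G x ys"
    if x_inst: "x \<in> gclf_instances G" for x :: "'v list \<times> ('v, 'g) gclf"
  proof -
    obtain vs P where x: "x = (vs, P)" "gclf_problem G P" "distinct vs" "set vs = ground P"
      using x_inst by (cases x) (auto simp: gclf_instances_def)
    let ?L = "length (gclf_encoding e x)"
    obtain t b s ys where *: "exec (compile solver) (init_state (gclf_encoding e x)) t b s"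
      "t \<le> poly (ctime solver) (poly Xp (length vs))" "b \<le> poly Xp (length vs) ^ cdeg solver + 3"
      "holds_output s ys" "gclf_correct_output G x ys"
      using solver_correct[OF x(2-4) refl refl] unfolding x(1) Xp by blast
    have L: "length vs \<le> ?L" by (simp add: x(1) gclf_encoding_codes length_input_codes)
    then have "length vs \<le> (\<Sum>z\<leftarrow>gclf_encoding e x. rat_bits z)"
      using length_le_sum_rat_bits[of "gclf_encoding e x"] by simp
    then have "poly Xp (length vs) ^ cdeg solver + 3 \<le> poly q (\<Sum>z\<leftarrow>gclf_encoding e x. rat_bits z)"
      by (simp add: q_def poly_power power_mono poly_nat_mono)
    moreover have "poly (ctime solver) (poly Xp (length vs)) \<le> poly p ?L"
      unfolding p_def poly_pcompose using L by (intro poly_nat_mono)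
    ultimately show ?thesis using * by (meson order_trans)
  qed
  then show ?thesis unfolding solvable_in_strongly_polynomial_time_def by blast
qed

end

theorem theorem3p2:
  fixes G :: "('g, 'm) monoid_scheme" and e :: "'g \<Rightarrow> nat"
  assumes "comm_group G" and "finite (carrier G)"
    and "bij_betw e (carrier G) {..<card (carrier G)}"
  shows "solvable_in_strongly_polynomial_time
    (gclf_instances G :: ('v list \<times> ('v, 'g) gclf) set) (gclf_encoding e) (gclf_correct_output G)"
  using gclf_solvable[OF assms] .

end
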